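(* Let $n_i$ be a CA3 number and let $p$ be the smallest prime greater than $P(n_i)$. (1) If $\epsilon_{i+1}=F(q,k)$ for a prime $q\ge 3$ and an integer $k\ge1$, then $n_{i+1}/n_i=q$ and $G(n_i)<G(n_{i+1})$. (2) If $\epsilon_{i+1}=F(q,k)$ for a prime $q\ge 23$ and an integer $k\ge 1$, then $n_{i+1}/n_i=q$ and $$G(n_i)<G(n_{i+1})\left(1-\frac{(\log q)^2}{3p^2\log p}\right).$$ (3) If $\epsilon_{i+1}=F(q,k)=F(r,j)$ for primes $q\ge 23$, $r\ge 23$ and integers $k,j\ge1$, then $n_{i+1}/n_i=qr$ and $$G(n_i)<G(n_{i+1})\left(1-\frac{(\log q)^2}{3p^2\log p}\right)\left(1-\frac{(\log r)^2}{3p^2\log p}\right).$$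
   Context: For an integer $n\ge 1$ let $\sigma(n)=\sum_{d\mid n}d$ and $\rho(n)=\sigma(n)/n$; for $n\ge 2$ let $G(n)=\rho(n)/\log\log n$. For real $x>1$ and integer $k\ge1$ let $F(x,k)=\dfrac{\log\left(1+\frac{1}{x+x^2+\cdots+x^k}\right)}{\log x}$. Let $E=\{F(p,k): p\text{ prime},\ k\ge 1\text{ integer}\}$, indexed in decreasing order $\epsilon_1>\epsilon_2>\cdots$. For $\epsilon\in E$ and each integer $k\ge1$ let $x_k$ be the unique real $x>1$ with $F(x,k)=\epsilon$. For each prime $p$ put $a_p=k$ if $x_{k+1}<p\le x_k$, and $a_p=0$ if $p>x_1$; $\prod_p p^{a_p}$ is the CA (colossally abundant) number constructed from $\epsilon$. Let $n_i$ be the CA number constructed from $\epsilon_i$ ($n_1<n_2<\cdots$). $P(n)$ denotes the largest prime factor of $n\ge2$. With $p$ the smallest prime greater than $P(n_i)$, $n_i$ is a CA3 number if $p<\log n_i$.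
   Formalization: In (1) and (2) the claim n_{i+1}/n_i = q is made only when q is the sole prime with ε_{i+1} = F(q,k), though the G-inequalities hold without this; in (3) q and r are distinct. Read literally, (2) and (3) give different quotients when r = q or when two primes share the value. *)

theory Defs
  imports Complex_Main "HOL-Computational_Algebra.Primes"
begin

definition sigma :: "nat \<Rightarrow> nat" where
  "sigma n = (\<Sum>d | d dvd n. d)"

definition rho :: "nat \<Rightarrow> real" where
  "rho n = real (sigma n) / real n"

definition G :: "nat \<Rightarrow> real" where
  "G n = rho n / ln (ln (real n))"

definition ca_F :: "real \<Rightarrow> nat \<Rightarrow> real" where
  "ca_F x k = ln (1 + 1 / (\<Sum>j=1..k. x ^ j)) / ln x"

definition ca_E :: "real set" where
  "ca_E = {ca_F (real p) k | p k :: nat. prime p \<and> k \<ge> 1}"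

text \<open>The decreasing enumeration of \<^term>\<open>ca_E\<close>, indexed from 1: the \<open>i\<close>-th term is the element
  with exactly \<open>i - 1\<close> larger elements above it.  The finiteness condition is there because
  \<^const>\<open>card\<close> is 0 on infinite sets.  The index 0 is not used.\<close>

definition ca_eps :: "nat \<Rightarrow> real" where
  "ca_eps i = (THE e. e \<in> ca_E \<and> finite {e' \<in> ca_E. e' > e} \<and> card {e' \<in> ca_E. e' > e} = i - 1)"

definition ca_x :: "real \<Rightarrow> nat \<Rightarrow> real" where
  "ca_x e k = (THE x. x > 1 \<and> ca_F x k = e)"

definition ca_exponent :: "real \<Rightarrow> nat \<Rightarrow> nat" where
  "ca_exponent e p =
     (if real p > ca_x e 1 then 0
      else THE k. k \<ge> 1 \<and> ca_x e (k + 1) < real p \<and> real p \<le> ca_x e k)"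

text \<open>Primes above \<open>x\<^sub>1\<close> have exponent 0, so the product over all primes reduces to the finite
  product below.\<close>

definition ca_number :: "real \<Rightarrow> nat" where
  "ca_number e = (\<Prod>p | prime p \<and> real p \<le> ca_x e 1. p ^ ca_exponent e p)"

definition ca_n :: "nat \<Rightarrow> nat" where
  "ca_n i = ca_number (ca_eps i)"

definition largest_prime_factor :: "nat \<Rightarrow> nat" where
  "largest_prime_factor n = Max (prime_factors n)"

definition next_prime :: "nat \<Rightarrow> nat" where
  "next_prime m = (LEAST p. prime p \<and> p > m)"

definition CA3 :: "nat \<Rightarrow> bool" where
  "CA3 n \<longleftrightarrow> (\<exists>i\<ge>1. n = ca_n i) \<and> real (next_prime (largest_prime_factor n)) < ln (real n)"

text \<open>\<open>e\<close> is a value of \<^const>\<open>ca_F\<close> at no prime other than \<open>q\<close>.  Whether a value can be shared by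
  two distinct primes is an open problem; when it is, the quotient of consecutive CA numbers is
  not a prime.\<close>

definition ca_sole_prime :: "real \<Rightarrow> nat \<Rightarrow> bool" where
  "ca_sole_prime e q \<longleftrightarrow> (\<forall>r j. prime r \<and> j \<ge> 1 \<and> e = ca_F (real r) j \<longrightarrow> r = q)"

end

theory Submission
  imports Defs "HOL-Library.FuncSet" "HOL-Computational_Algebra.Polynomial"
begin

text \<open>
  Let \<open>e\<close> be the value following \<open>\<epsilon>\<^sub>i\<close> and let \<open>M\<close> be the product of the primes at which \<open>e\<close> is attained.
  Then \<open>n\<^sub>i\<^sub>+\<^sub>1 = n\<^sub>i M\<close>, and since \<open>1 + 1 / (q + \<dots> + q^k) = q powr F(q, k)\<close>, the factor gained in \<open>\<rho>\<close> is
  \<open>M powr e\<close>.  The prime \<open>p\<close> does not divide \<open>n\<^sub>i\<close>, so \<open>e \<ge> F(p, 1)\<close> and \<open>M powr e \<ge> (1 + 1/p) powr y\<close>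
  with \<open>y = ln M / ln p\<close>.  On the other side \<open>ln n\<^sub>i > p\<close> bounds the quotient of the iterated
  logarithms by \<open>1 + ln (1 + ln M / p) / ln p\<close>.  Both bounds are \<open>1 + y/p\<close> to first order, and the
  second order terms leave a gain of about \<open>y (ln M - 1 + y) / (2 p\<^sup>2)\<close>.

  At most two primes can share the value \<open>e\<close>: for three of them the powers \<open>q powr e\<close> would all be
  rational with \<open>e\<close> irrational, contrary to the six exponentials theorem.  In this rational case
  there is a real-variable proof, with Rolle's theorem in place of the Schwarz lemma.
\<close>

section \<open>Zeros of exponential sums\<close>

text \<open>Zeros are added in increasing order, and Rolle is applied between the largest old zero
  and the new one. The clause that each zero of \<open>f'\<close> lies below some element of
  \<open>Z\<close> is carried through the induction to show that the zero so obtained is a new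
  one.\<close>

lemma Rolle_zeros_deriv:
  fixes f f' :: "real \<Rightarrow> real"
  assumes "finite Z" and "\<And>x. (f has_real_derivative f' x) (at x)"
    and "Z \<subseteq> {a..b}" and "\<forall>z\<in>Z. f z = 0"
  shows "\<exists>Z'. finite Z' \<and> Z' \<subseteq> {a..b} \<and> card Z \<le> Suc (card Z') \<and> (\<forall>z\<in>Z'. f' z = 0 \<and> (\<exists>w\<in>Z. z < w))"
  using assms(1,3,4)
proof (induction Z rule: finite_linorder_max_induct)
  case empty
  show ?case by (intro exI[of _ "{}"]) auto
next
  case (insert m A)
  show ?case
  proof (cases "A = {}")
    case True
    then show ?thesis by (intro exI[of _ "{}"]) auto
  next
    case False
    from insert obtain Z' where Z': "finite Z'" "Z' \<subseteq> {a..b}" "card A \<le> Suc (card Z')"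
      "\<forall>z\<in>Z'. f' z = 0 \<and> (\<exists>w\<in>A. z < w)" by auto
    define m0 where "m0 = Max A"
    have m0: "m0 \<in> A" "\<forall>w\<in>A. w \<le> m0" "m0 < m" using insert False by (auto simp: m0_def)
    have "\<exists>z. m0 < z \<and> z < m \<and> DERIV f z :> 0"
    proof (rule Rolle)
      show "f m0 = f m" using insert.prems m0 by auto
      show "continuous_on {m0..m} f"
        using assms(2) by (meson DERIV_isCont continuous_at_imp_continuous_on)
      show "f differentiable (at x)" for x
        using assms(2) real_differentiable_def by blast
    qed (use m0 in auto)
    then obtain z where z: "m0 < z" "z < m" "DERIV f z :> 0" by blast
    have "f' z = 0" using z(3) assms(2) DERIV_unique by blast
    moreover have "z \<notin> Z'" using Z'(4) m0(2) z(1) by force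
    moreover have "z \<in> {a..b}" using insert.prems(1) m0(1) z by auto
    moreover have "m \<notin> A" using insert by auto
    ultimately show ?thesis using Z' z insert.hyps(1)
      by (intro exI[of _ "insert z Z'"]) auto
  qed
qed

text \<open>Dividing by \<open>exp (x j * t)\<close> makes the term of index \<open>j\<close>
  constant, so differentiation removes it at the cost of one zero. This is the Chebyshev property of
  real exponentials with distinct exponents.\<close>

lemma exp_sum_zeros:
  fixes x c :: "'a \<Rightarrow> real"
  assumes "finite I" "inj_on x I" "finite Z" "card I \<le> card Z"
    and "\<forall>t\<in>Z. (\<Sum>i\<in>I. c i * exp (x i * t)) = 0"
  shows "\<forall>i\<in>I. c i = 0"
  using assms
proof (induction I arbitrary: x c Z rule: finite_induct)
  case (insert j I)
  define g where "g t = (\<Sum>i\<in>insert j I. c i * exp ((x i - x j) * t))" for t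
  define g' where "g' t = (\<Sum>i\<in>I. (c i * (x i - x j)) * exp ((x i - x j) * t))" for t
  have der: "(g has_real_derivative g' t) (at t)" for t
  proof -
    have "((\<lambda>t. \<Sum>i\<in>insert j I. c i * exp ((x i - x j) * t)) has_real_derivative
        (\<Sum>i\<in>insert j I. c i * (exp ((x i - x j) * t) * (x i - x j)))) (at t)"
      by (intro DERIV_sum) (auto intro!: derivative_eq_intros)
    also have "(\<Sum>i\<in>insert j I. c i * (exp ((x i - x j) * t) * (x i - x j))) = g' t"
      using insert.hyps by (simp add: g'_def mult_ac)
    finally show ?thesis by (simp add: g_def[abs_def])
  qed
  have g: "g t = exp (- x j * t) * (\<Sum>i\<in>insert j I. c i * exp (x i * t))" for t
    unfolding g_def sum_distrib_left
    by (intro sum.cong refl) (simp add: algebra_simps flip: exp_add)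
  have fZ: "finite Z" by fact
  \<comment> \<open>Any interval around \<open>Z\<close> will do; inserting 0 gives
    \<open>Min\<close> and \<open>Max\<close> a nonempty set.\<close>
  have hull: "Z \<subseteq> {Min (insert 0 Z)..Max (insert 0 Z)}" using fZ by auto
  have gZ: "\<forall>z\<in>Z. g z = 0" using insert.prems g by auto
  obtain Z' where Z': "finite Z'" "card Z \<le> Suc (card Z')" "\<forall>z\<in>Z'. g' z = 0"
    using Rolle_zeros_deriv[OF fZ der hull gZ] by auto
  have "\<forall>i\<in>I. c i * (x i - x j) = 0"
  proof (rule insert.IH[OF _ Z'(1)])
    show "inj_on (\<lambda>i. x i - x j) I" using insert.prems(1) by (auto simp: inj_on_def)
    show "card I \<le> card Z'" using Z'(2) insert by simp
    show "\<forall>t\<in>Z'. (\<Sum>i\<in>I. c i * (x i - x j) * exp ((x i - x j) * t)) = 0"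
      using Z'(3) by (simp add: g'_def)
  qed
  moreover have "x i \<noteq> x j" if "i \<in> I" for i
    using insert.prems(1) insert.hyps(2) that by (auto simp: inj_on_def)
  ultimately have c0: "\<forall>i\<in>I. c i = 0" by auto
  have "Z \<noteq> {}" using insert by auto
  then obtain t where "t \<in> Z" by auto
  then have "(\<Sum>i\<in>insert j I. c i * exp (x i * t)) = 0" using insert by blast
  then have "c j = 0" using c0 insert.hyps by simp
  then show ?case using c0 by simp
qed simp

section \<open>Higher derivatives and the error of interpolation\<close>

lemma Rolle_zeros_higher_deriv:
  fixes f :: "nat \<Rightarrow> real \<Rightarrow> real"
  assumes "\<And>k x. (f k has_real_derivative f (Suc k) x) (at x)"
    and "finite Z" "Z \<subseteq> {a..b}" "\<forall>z\<in>Z. f 0 z = 0" "N < card Z"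
  shows "\<exists>\<xi>\<in>{a..b}. f N \<xi> = 0"
  using assms
proof (induction N arbitrary: f Z)
  case 0
  then have "Z \<noteq> {}" by auto
  then show ?case using 0 by blast
next
  case (Suc N)
  from Rolle_zeros_deriv[OF Suc.prems(2) Suc.prems(1)[of 0] Suc.prems(3,4)]
  obtain Z' where "finite Z'" "Z' \<subseteq> {a..b}" "card Z \<le> Suc (card Z')" "\<forall>z\<in>Z'. f 1 z = 0" by auto
  then show ?case using Suc.IH[of "\<lambda>k. f (Suc k)" Z'] Suc.prems by auto
qed

text \<open>The sequence \<open>f\<close> lists a function and its derivatives. A multiple of the
  monic polynomial \<open>P\<close> with root set \<open>Z\<close> is subtracted so that the
  difference also vanishes at \<open>t\<close>; having \<open>card Z + 1\<close> zeros, its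
  derivative of order \<open>card Z\<close> vanishes somewhere. The factorial is the derivative of
  that order of \<open>P\<close>.\<close>

lemma interpolation_error:
  fixes f :: "nat \<Rightarrow> real \<Rightarrow> real"
  assumes der: "\<And>k x. (f k has_real_derivative f (Suc k) x) (at x)"
    and Z: "finite Z" "Z \<subseteq> {a..b}" "\<forall>z\<in>Z. f 0 z = 0" and t: "t \<in> {a..b}" "t \<notin> Z"
  shows "\<exists>\<xi>\<in>{a..b}. f 0 t * fact (card Z) = f (card Z) \<xi> * (\<Prod>z\<in>Z. t - z)"
proof -
  define P where "P = (\<Prod>z\<in>Z. [:-z, 1:])"
  have P: "poly P s = (\<Prod>z\<in>Z. s - z)" for s by (simp add: P_def poly_prod)
  have Pt: "poly P t \<noteq> 0" using Z t by (auto simp: P)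
  have degP: "degree P = card Z" unfolding P_def by (subst degree_prod_sum_eq) auto
  have "lead_coeff P = 1" unfolding P_def by (simp add: lead_coeff_prod)
  then have lc: "coeff P (card Z) = 1" using degP by simp
  have PN: "poly ((pderiv ^^ card Z) P) s = fact (card Z)" for s
  proof -
    have "degree ((pderiv ^^ card Z) P) = 0" by (simp add: degree_higher_pderiv degP)
    then obtain c where c: "(pderiv ^^ card Z) P = [:c:]" by (metis degree_eq_zeroE)
    have "c = coeff ((pderiv ^^ card Z) P) 0" by (simp add: c)
    also have "\<dots> = fact (card Z)" by (simp add: coeff_higher_pderiv lc pochhammer_fact)
    finally show ?thesis by (simp add: c)
  qed
  define K where "K = f 0 t / poly P t"
  define g where "g k s = f k s - K * poly ((pderiv ^^ k) P) s" for k s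
  have "\<exists>\<xi>\<in>{a..b}. g (card Z) \<xi> = 0"
  proof (rule Rolle_zeros_higher_deriv)
    show "(g k has_real_derivative g (Suc k) x) (at x)" for k x
      unfolding g_def by (auto intro!: derivative_eq_intros der poly_DERIV)
    show "\<forall>z\<in>insert t Z. g 0 z = 0" using Z Pt by (auto simp: g_def K_def P)
  qed (use Z t in auto)
  then obtain \<xi> where xi: "\<xi> \<in> {a..b}" "f (card Z) \<xi> = K * fact (card Z)" by (auto simp: g_def PN)
  then show ?thesis using Pt by (intro bexI[of _ \<xi>]) (auto simp: K_def P)
qed

text \<open>Vectors with entries in \<open>{..C}\<close> are mapped to vectors with entries in
  \<open>{..C * C}\<close>, and \<open>(C * C + 1) ^ card J < (C + 1) ^ card I\<close>. Two vectors
  with the same image differ by a nonzero integer solution with entries at most \<open>C\<close> in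
  absolute value.\<close>

lemma Siegel_pigeonhole:
  fixes A :: "'b \<Rightarrow> 'a \<Rightarrow> nat"
  assumes fin: "finite I" "finite J" and card: "2 * card J \<le> card I" and I: "I \<noteq> {}"
    and A: "\<And>j i. j \<in> J \<Longrightarrow> i \<in> I \<Longrightarrow> A j i \<le> B" and B: "1 \<le> B"
  shows "\<exists>c :: 'a \<Rightarrow> int. (\<exists>i\<in>I. c i \<noteq> 0) \<and> (\<forall>i\<in>I. \<bar>c i\<bar> \<le> int (card I * B)) \<and>
           (\<forall>j\<in>J. (\<Sum>i\<in>I. c i * int (A j i)) = 0)"
proof -
  define C where "C = card I * B"
  have "0 < card I" using fin I by (simp add: card_gt_0_iff)
  then have C: "1 \<le> C" using B by (simp add: C_def Suc_le_eq)
  define D where "D = (\<Pi>\<^sub>E i\<in>I. {..C})"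
  define R where "R = (\<Pi>\<^sub>E j\<in>J. {..C * C})"
  define \<phi> where "\<phi> v = (\<lambda>j\<in>J. \<Sum>i\<in>I. v i * A j i)" for v
  have "\<phi> ` D \<subseteq> R"
  proof
    fix w assume "w \<in> \<phi> ` D"
    then obtain v where v: "v \<in> D" "w = \<phi> v" by auto
    have "(\<Sum>i\<in>I. v i * A j i) \<le> C * C" if "j \<in> J" for j
    proof -
      have "(\<Sum>i\<in>I. v i * A j i) \<le> (\<Sum>i\<in>I. C * B)"
        using v that A by (intro sum_mono mult_mono) (auto simp: D_def PiE_iff)
      then show ?thesis by (simp add: C_def algebra_simps)
    qed
    then show "w \<in> R" using v by (auto simp: R_def \<phi>_def)
  qed
  moreover have finR: "finite R" unfolding R_def using fin by (intro finite_PiE) auto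
  ultimately have "card (\<phi> ` D) \<le> card R" by (rule card_mono[rotated])
  also have "card R = (C * C + 1) ^ card J"
    unfolding R_def using fin by (simp add: card_PiE)
  also have "\<dots> < (C + 1) ^ card I"
  proof (cases "card J = 0")
    case True
    have "1 < C + 1" using C by simp
    then show ?thesis using True \<open>0 < card I\<close> by (metis one_less_power power_0)
  next
    case False
    have "(C * C + 1) ^ card J < ((C + 1) * (C + 1)) ^ card J"
      using C False by (intro power_strict_mono) auto
    also have "\<dots> = (C + 1) ^ (2 * card J)" by (simp add: power_mult power2_eq_square)
    also have "\<dots> \<le> (C + 1) ^ card I" using card by (intro power_increasing) auto
    finally show ?thesis .
  qed
  also have "\<dots> = card D" unfolding D_def using fin by (simp add: card_PiE)
  finally have "\<not> inj_on \<phi> D" by (rule pigeonhole)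
  then obtain v w where vw: "v \<in> D" "w \<in> D" "\<phi> v = \<phi> w" "v \<noteq> w" by (auto simp: inj_on_def)
  have "\<exists>i\<in>I. v i \<noteq> w i"
    using vw(1,2,4) unfolding D_def by (meson PiE_ext)
  moreover have "\<bar>int (v i) - int (w i)\<bar> \<le> int C" if "i \<in> I" for i
  proof -
    have "v i \<le> C" "w i \<le> C" using vw that by (auto simp: D_def PiE_iff)
    then show ?thesis by linarith
  qed
  moreover have "(\<Sum>i\<in>I. (int (v i) - int (w i)) * int (A j i)) = 0" if "j \<in> J" for j
  proof -
    have "(\<Sum>i\<in>I. v i * A j i) = (\<Sum>i\<in>I. w i * A j i)"
      using fun_cong[OF vw(3), of j] that by (simp add: \<phi>_def)
    then have "int (\<Sum>i\<in>I. v i * A j i) = int (\<Sum>i\<in>I. w i * A j i)" by simp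
    then show ?thesis by (simp add: left_diff_distrib sum_subtractf)
  qed
  ultimately show ?thesis
    by (intro exI[of _ "\<lambda>i. int (v i) - int (w i)"]) (auto simp: C_def)
qed

text \<open>An integer combination of the functions \<open>exp (x i * t)\<close> that vanishes on \<open>P0\<close> cannot vanish
  on all of \<open>P1\<close>.  At a point where it does not, clearing the denominator bounds it below, and the
  interpolation error bounds it above.\<close>

lemma exp_values_bound:
  fixes x :: "'a \<Rightarrow> real" and V :: "real \<Rightarrow> nat" and A :: "real \<Rightarrow> 'a \<Rightarrow> nat" and B :: nat
  assumes I: "finite I" "I \<noteq> {}" "inj_on x I" "\<And>i. i \<in> I \<Longrightarrow> 0 \<le> x i \<and> x i \<le> X"
    and P: "finite P0" "finite P1" "P0 \<subseteq> {0..Y}" "P1 \<subseteq> {0..Y}"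
    and card: "2 * card P0 \<le> card I" "card I \<le> card P1"
    and V: "\<And>t. t \<in> P0 \<union> P1 \<Longrightarrow> 1 \<le> V t \<and> V t \<le> B"
    and A: "\<And>t i. t \<in> P0 \<union> P1 \<Longrightarrow> i \<in> I \<Longrightarrow> real (V t) * exp (x i * t) = real (A t i) \<and> A t i \<le> B"
    and B: "exp (X * Y) \<le> real B"
  shows "fact (card P0) \<le> (X * Y) ^ card P0 * real (card I) ^ 2 * real B ^ 3"
proof -
  have X0: "0 \<le> X" using I by fastforce
  have L: "0 < card I" using I by (simp add: card_gt_0_iff)
  then have "P1 \<noteq> {}" using card by auto
  then have Y0: "0 \<le> Y" using P by fastforce
  have "0 < exp (X * Y)" by simp
  then have "0 < real B" using B by linarith
  then have B1: "1 \<le> B" by simp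
  obtain c :: "'a \<Rightarrow> int" where c: "\<exists>i\<in>I. c i \<noteq> 0" "\<forall>i\<in>I. \<bar>c i\<bar> \<le> int (card I * B)"
    "\<forall>t\<in>P0. (\<Sum>i\<in>I. c i * int (A t i)) = 0"
    using Siegel_pigeonhole[OF I(1) P(1) card(1) I(2), of A B] A B1 by blast
  \<comment> \<open>\<open>f k\<close> is the k-th derivative of the exponential sum with
    coefficients \<open>c\<close>. Multiplication by \<open>V t\<close> makes \<open>f 0 t\<close>
    an integer at the points of both sets.\<close>
  define f where "f k t = (\<Sum>i\<in>I. of_int (c i) * x i ^ k * exp (x i * t))" for k t
  have der: "(f k has_real_derivative f (Suc k) t) (at t)" for k t
    unfolding f_def by (intro DERIV_sum) (auto intro!: derivative_eq_intros)
  have f0: "real (V t) * f 0 t = of_int (\<Sum>i\<in>I. c i * int (A t i))" if "t \<in> P0 \<union> P1" for t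
  proof -
    have "real (V t) * f 0 t = (\<Sum>i\<in>I. of_int (c i) * (real (V t) * exp (x i * t)))"
      by (simp add: f_def sum_distrib_left mult_ac)
    also have "\<dots> = (\<Sum>i\<in>I. of_int (c i) * real (A t i))"
      using A[OF that] by (intro sum.cong) auto
    finally show ?thesis by simp
  qed
  have zero: "\<forall>z\<in>P0. f 0 z = 0"
  proof
    fix z assume z: "z \<in> P0"
    then have "real (V z) * f 0 z = 0" using c(3) f0[of z] by simp
    then show "f 0 z = 0" using V[of z] z by simp
  qed
  have "\<exists>t\<in>P1. f 0 t \<noteq> 0"
  proof (rule ccontr)
    assume "\<not> ?thesis"
    then have "\<forall>t\<in>P1. (\<Sum>i\<in>I. of_int (c i) * exp (x i * t)) = 0" by (simp add: f_def)
    from exp_sum_zeros[OF I(1,3) P(2) card(2) this] show False using c(1) by auto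
  qed
  then obtain t where t: "t \<in> P1" "f 0 t \<noteq> 0" by blast
  define N where "N = card P0"
  have "t \<in> {0..Y}" "t \<notin> P0" using t P zero by auto
  from interpolation_error[OF der P(1,3) zero this]
  obtain \<xi> where xi: "\<xi> \<in> {0..Y}" "f 0 t * fact N = f N \<xi> * (\<Prod>z\<in>P0. t - z)"
    by (auto simp: N_def)
  have "1 \<le> \<bar>real (V t) * f 0 t\<bar>"
  proof -
    have "real (V t) * f 0 t \<noteq> 0" using t V[of t] by auto
    moreover obtain z :: int where "real (V t) * f 0 t = of_int z" using f0[of t] t by blast
    ultimately show ?thesis by (simp flip: of_int_abs)
  qed
  also have "\<dots> \<le> real B * \<bar>f 0 t\<bar>"
    using V[of t] t by (auto simp: abs_mult intro!: mult_right_mono)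
  finally have low: "1 \<le> real B * \<bar>f 0 t\<bar>" .
  have prod: "\<bar>\<Prod>z\<in>P0. t - z\<bar> \<le> Y ^ N"
  proof -
    have "\<bar>\<Prod>z\<in>P0. t - z\<bar> = (\<Prod>z\<in>P0. \<bar>t - z\<bar>)" by (simp add: abs_prod)
    also have "\<dots> \<le> (\<Prod>z\<in>P0. Y)"
      using \<open>t \<in> {0..Y}\<close> P(3) by (intro prod_mono) (fastforce simp: abs_if)
    finally show ?thesis by (simp add: N_def)
  qed
  have fN: "\<bar>f N \<xi>\<bar> \<le> real (card I) * (real (card I * B) * X ^ N * real B)"
  proof -
    have "\<bar>f N \<xi>\<bar> \<le> (\<Sum>i\<in>I. \<bar>of_int (c i) * x i ^ N * exp (x i * \<xi>)\<bar>)"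
      unfolding f_def by (rule sum_abs)
    also have "\<dots> \<le> (\<Sum>i\<in>I. real (card I * B) * X ^ N * real B)"
    proof (rule sum_mono)
      fix i assume i: "i \<in> I"
      have "real_of_int \<bar>c i\<bar> \<le> real_of_int (int (card I * B))" using c(2) i by (subst of_int_le_iff) blast
      then have 1: "\<bar>real_of_int (c i)\<bar> \<le> real (card I * B)" by simp
      have 2: "\<bar>x i\<bar> ^ N \<le> X ^ N" using I(4)[OF i] by (intro power_mono) auto
      have "x i * \<xi> \<le> X * Y" using I(4)[OF i] xi(1) X0 by (intro mult_mono) auto
      then have 3: "exp (x i * \<xi>) \<le> real B" using B by (meson exp_le_cancel_iff order_trans)
      show "\<bar>of_int (c i) * x i ^ N * exp (x i * \<xi>)\<bar> \<le> real (card I * B) * X ^ N * real B"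
        unfolding abs_mult power_abs abs_exp_cancel
        using 1 2 3 X0 by (intro mult_mono) auto
    qed
    finally show ?thesis by simp
  qed
  \<comment> \<open>One factor \<open>B\<close> is the denominator, one bounds the coefficients and
    one the exponentials. The two factors \<open>card I\<close> come from the number of terms and
    again from the coefficients.\<close>
  have "fact N \<le> fact N * (real B * \<bar>f 0 t\<bar>)" using low by simp
  also have "\<dots> = real B * \<bar>f 0 t * fact N\<bar>" by (simp add: abs_mult)
  also have "\<dots> = real B * (\<bar>f N \<xi>\<bar> * \<bar>\<Prod>z\<in>P0. t - z\<bar>)" by (simp add: xi(2) abs_mult)
  also have "\<dots> \<le> real B * ((real (card I) * (real (card I * B) * X ^ N * real B)) * Y ^ N)"
    using fN prod X0 by (intro mult_left_mono mult_mono) auto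
  finally show ?thesis by (simp add: N_def power_mult_distrib power2_eq_square power3_eq_cube mult_ac)
qed

section \<open>Six exponentials with rational values\<close>

text \<open>One term of the series for \<open>exp (real n)\<close> is
  \<open>real n ^ n / fact n\<close>, and \<open>exp 1 \<le> 3\<close>.\<close>

lemma fact_ge_power_div_3: "(real n / 3) ^ n \<le> fact n"
proof -
  have "(\<Sum>k\<in>{n}. real n ^ k /\<^sub>R fact k) \<le> (\<Sum>k. real n ^ k /\<^sub>R fact k)"
    by (rule sum_le_suminf[OF summable_exp_generic]) auto
  then have "real n ^ n / fact n \<le> exp (real n)" by (simp add: exp_def divide_inverse mult.commute)
  also have "\<dots> = exp 1 ^ n" by (simp add: exp_of_nat_mult[symmetric])
  also have "\<dots> \<le> 3 ^ n" using exp_le by (intro power_mono) auto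
  finally show ?thesis by (simp add: power_divide field_simps)
qed

text \<open>With \<open>N = 8 * s ^ 6\<close> the factorial is at least \<open>(N / 3) ^ N\<close>,
  whereas the left side is at most \<open>(2 * K * H * s ^ 5) ^ N\<close>, so a large
  \<open>s\<close> decides. The left side is the bound of \<open>exp_values_bound\<close> for the
  parameters used with six exponentials.\<close>

lemma power_bound_less_fact:
  fixes K :: real and H :: nat
  assumes "0 \<le> K" "1 \<le> H"
  shows "\<exists>s\<ge>1. (K * real s ^ 5) ^ (8 * s ^ 6) * real (16 * s ^ 6) ^ 2 * real (H ^ (32 * s ^ 5)) ^ 3
           < fact (8 * s ^ 6)"
proof -
  obtain s0 :: nat where s0: "2 * K * H < real s0" using reals_Archimedean2 by blast
  \<comment> \<open>\<open>s0\<close> beats the constant \<open>2 * K * H\<close>; the 12 is what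
    \<open>3 * 32 * s ^ 5 \<le> 8 * s ^ 6\<close> requires.\<close>
  define s where "s = max s0 12"
  have s: "2 * K * H < real s" "12 \<le> s" using s0 by (auto simp: s_def)
  define N where "N = 8 * s ^ 6"
  have N0: "0 < N" using s by (simp add: N_def)
  have 1: "real (16 * s ^ 6) ^ 2 \<le> 2 ^ N"
  proof -
    define z where "z = s ^ 6"
    have "2 ^ 6 \<le> s ^ 6" using s by (intro power_mono) auto
    then have z: "2 \<le> z" by (simp add: z_def)
    have "(16 * z) ^ 2 \<le> (16 * 2 ^ z) ^ 2"
      using less_exp[of z] by (intro power_mono mult_left_mono) auto
    also have "\<dots> = 2 ^ (8 + 2 * z)" by (simp add: power_mult_distrib power_add power_even_eq)
    also have "\<dots> \<le> 2 ^ (8 * z)" using z by (intro power_increasing) auto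
    finally have "real ((16 * z) ^ 2) \<le> real (2 ^ (8 * z))" by (rule of_nat_mono)
    then show ?thesis by (simp add: N_def z_def)
  qed
  have 2: "real (H ^ (32 * s ^ 5)) ^ 3 \<le> real H ^ N"
  proof -
    have "s ^ 5 * 12 \<le> s ^ 5 * s" using s by (intro mult_left_mono) auto
    then have "32 * s ^ 5 * 3 \<le> N" by (simp add: N_def power_Suc2[symmetric] del: power_Suc)
    then have "real H ^ (32 * s ^ 5 * 3) \<le> real H ^ N" using assms by (intro power_increasing) auto
    then show ?thesis by (simp flip: power_mult)
  qed
  have "(K * real s ^ 5) ^ N * real (16 * s ^ 6) ^ 2 * real (H ^ (32 * s ^ 5)) ^ 3
      \<le> (K * real s ^ 5) ^ N * 2 ^ N * real H ^ N"
    using 1 2 assms by (intro mult_mono) auto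
  also have "\<dots> = (2 * K * H * real s ^ 5) ^ N" by (simp add: power_mult_distrib mult_ac)
  also have "\<dots> < (real N / 3) ^ N"
  proof (rule power_strict_mono)
    have "2 * K * H * real s ^ 5 < real s * real s ^ 5"
      using s by (intro mult_strict_right_mono) auto
    also have "\<dots> \<le> real N / 3" by (simp add: N_def power_Suc[symmetric] del: power_Suc)
    finally show "2 * K * H * real s ^ 5 < real N / 3" .
  qed (use N0 assms in auto)
  also have "\<dots> \<le> fact N" by (rule fact_ge_power_div_3)
  finally show ?thesis using s by (intro exI[of _ s]) (auto simp: N_def)
qed

lemma monomial_le_power:
  fixes x y z :: nat
  assumes "1 \<le> x" "1 \<le> y" "1 \<le> z" "a \<le> n" "b \<le> n" "c \<le> n" "x * y * z \<le> H"
  shows "x ^ a * y ^ b * z ^ c \<le> H ^ n"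
proof -
  have "x ^ a * y ^ b * z ^ c \<le> x ^ n * y ^ n * z ^ n"
    using assms by (intro mult_mono power_increasing) auto
  also have "\<dots> = (x * y * z) ^ n" by (simp add: power_mult_distrib)
  also have "\<dots> \<le> H ^ n" using assms by (intro power_mono) auto
  finally show ?thesis .
qed

text \<open>The case of the six exponentials theorem in which all six values are rational.  The bound
  above is applied to the exponents \<open>m + n e\<close> with \<open>m, n < S\<close> and to the points
  \<open>a ln q1 + b ln q2 + c ln q3\<close> with \<open>a, b, c < T\<close> and \<open>a, b, c < 2 T\<close>; the choice \<open>S = 4 s^3\<close>,
  \<open>T = 2 s^2\<close> makes the number of exponents exactly twice the number of points in the first box.\<close>

theorem six_exponentials_rational:
  fixes e :: real and q1 q2 q3 u1 u2 u3 v1 v2 v3 :: nat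
  assumes e: "e \<notin> \<rat>" "0 \<le> e" and q: "1 \<le> q1" "1 \<le> q2" "1 \<le> q3"
    and inj: "inj (\<lambda>(a, b, c). q1 ^ a * q2 ^ b * q3 ^ c)"
    and v: "1 \<le> v1" "1 \<le> v2" "1 \<le> v3"
    and uv: "real q1 powr e = real u1 / real v1" "real q2 powr e = real u2 / real v2"
      "real q3 powr e = real u3 / real v3"
  shows False
proof -
  have "0 < real u1 / real v1" "0 < real u2 / real v2" "0 < real u3 / real v3"
    using q by (auto simp flip: uv)
  then have u: "1 \<le> u1" "1 \<le> u2" "1 \<le> u3" using v by (auto simp: zero_less_divide_iff)
  \<comment> \<open>For a triple of exponents, \<open>w\<close> is the monomial in the bases, and
    \<open>U\<close>, \<open>V\<close> are numerator and denominator of \<open>w\<close> raised to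
    the power \<open>e\<close>. The logarithm \<open>f\<close> of \<open>w\<close> is the evaluation
    point; being injective, it lets \<open>inv f\<close> recover the triple from the point.\<close>
  define w where "w = (\<lambda>(a, b, c). q1 ^ a * q2 ^ b * q3 ^ c)"
  define U where "U = (\<lambda>(a, b, c). u1 ^ a * u2 ^ b * u3 ^ c)"
  define V where "V = (\<lambda>(a, b, c). v1 ^ a * v2 ^ b * v3 ^ c)"
  have pos: "1 \<le> w \<tau>" "1 \<le> U \<tau>" "1 \<le> V \<tau>" for \<tau>
    using q u v by (auto simp: w_def U_def V_def Suc_le_eq split: prod.splits)
  define f where "f \<tau> = ln (real (w \<tau>))" for \<tau>
  have "inj f"
  proof (rule injI)
    fix \<tau> \<tau>' assume "f \<tau> = f \<tau>'"
    then have "w \<tau> = w \<tau>'" using pos(1)[of \<tau>] pos(1)[of \<tau>'] by (simp add: f_def)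
    then show "\<tau> = \<tau>'" using inj by (simp add: w_def inj_eq)
  qed
  have powr: "real (w \<tau>) powr e = real (U \<tau>) / real (V \<tau>)" for \<tau>
  proof -
    have *: "real (x ^ a) powr e = (real x powr e) ^ a" if "1 \<le> x" for x a :: nat
      using that by (simp add: powr_powr powr_realpow[symmetric] mult.commute)
    obtain a b c where "\<tau> = (a, b, c)" using prod_cases3 by blast
    then show ?thesis
      using q by (simp add: w_def U_def V_def powr_mult * uv power_divide del: of_nat_power)
        (simp add: field_simps)
  qed
  define y where "y = ln (real (q1 * q2 * q3))"
  define h where "h = q1 * q2 * q3 + u1 * u2 * u3 + v1 * v2 * v3"
  \<comment> \<open>One base \<open>H\<close> dominates the products of the bases, numerators and
    denominators as well as the exponential, so every integer that occurs is bounded by a power of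
    \<open>H\<close>.\<close>
  define H where "H = h + nat \<lceil>exp ((1 + e) * y)\<rceil>"
  have y0: "0 \<le> y" using q by (auto simp: y_def Suc_le_eq simp del: of_nat_mult intro!: ln_ge_zero)
  have H: "exp ((1 + e) * y) \<le> real H" by (simp add: H_def) linarith
  have H1: "1 \<le> H" using q by (simp add: H_def h_def Suc_le_eq)
  have le: "w (a, b, c) \<le> H ^ n" "U (a, b, c) \<le> H ^ n" "V (a, b, c) \<le> H ^ n"
    if "a \<le> n" "b \<le> n" "c \<le> n" for a b c n
    using that q u v unfolding w_def U_def V_def prod.case
    by (intro monomial_le_power; simp add: H_def h_def)+
  \<comment> \<open>With \<open>X = S * (1 + e)\<close> and \<open>Y = 2 * T * y\<close> the product
    \<open>X * Y\<close> becomes \<open>K * s ^ 5\<close>; the 16 is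
    \<open>4 * 2 * 2\<close>.\<close>
  define K where "K = 16 * (1 + e) * y"
  have "0 \<le> K" using y0 e by (simp add: K_def)
  from power_bound_less_fact[OF this H1] obtain s :: nat where s: "1 \<le> s"
    "(K * real s ^ 5) ^ (8 * s ^ 6) * real (16 * s ^ 6) ^ 2 * real (H ^ (32 * s ^ 5)) ^ 3
           < fact (8 * s ^ 6)" by blast
  \<comment> \<open>The exponent in \<open>B\<close> is \<open>2 * T\<close> for the entries of a
    triple, times \<open>2 * S\<close> for \<open>m + n + (S - n)\<close>, the total degree of the
    entry \<open>A t (m, n)\<close> in \<open>w\<close>, \<open>U\<close> and
    \<open>V\<close>.\<close>
  define T S B where "T = 2 * s ^ 2" and "S = 4 * s ^ 3" and "B = H ^ (2 * T * (2 * S))"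
  define box where "box n = {..<n} \<times> {..<n} \<times> {..<n}" for n :: nat
  define x where "x = (\<lambda>(m, n). real m + real n * e)"
  define I where "I = {..<S} \<times> {..<S}"
  \<comment> \<open>The exponential with exponent \<open>m + n * e\<close> has the value
    \<open>w ^ m * (U / V) ^ n\<close> with \<open>n < S\<close>, so \<open>V ^ S\<close> is a
    common denominator at each point.\<close>
  define val where "val t = V (inv f t) ^ S" for t
  define A where "A t = (\<lambda>(m, n). w (inv f t) ^ m * U (inv f t) ^ n * V (inv f t) ^ (S - n))" for t
  have cardP: "card (f ` box n) = n ^ 3" for n
    using \<open>inj f\<close> by (subst card_image) (auto simp: box_def power3_eq_cube inj_on_def)
  have cardI: "card I = S\<^sup>2" by (simp add: I_def power2_eq_square)
  have sub: "f ` box T \<union> f ` box (2 * T) = f ` box (2 * T)" by (auto simp: box_def)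
  have cards: "card (f ` box T) = 8 * s ^ 6" "card I = 16 * s ^ 6" "card (f ` box (2 * T)) = 64 * s ^ 6"
    by (simp_all add: cardP cardI T_def S_def power_mult_distrib flip: power_mult)
  have range: "f ` box n \<subseteq> {0..real n * y}" for n
  proof -
    have "0 \<le> f \<tau> \<and> f \<tau> \<le> real n * y" if "\<tau> \<in> box n" for \<tau>
    proof -
      obtain a b c where abc: "\<tau> = (a, b, c)" "a \<le> n" "b \<le> n" "c \<le> n"
        using \<open>\<tau> \<in> box n\<close> by (auto simp: box_def)
      have "w \<tau> \<le> (q1 * q2 * q3) ^ n"
        unfolding w_def abc(1) prod.case using abc q by (intro monomial_le_power) auto
      then have "real (w \<tau>) \<le> real (q1 * q2 * q3) ^ n" by (metis of_nat_le_iff of_nat_power)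
      moreover have "0 < real (w \<tau>)" using pos(1)[of \<tau>] by simp
      ultimately have "f \<tau> \<le> ln (real (q1 * q2 * q3) ^ n)" unfolding f_def by (intro ln_mono)
      also have "\<dots> = real n * y"
        unfolding y_def by (rule ln_realpow)
      finally show ?thesis using pos(1)[of \<tau>] by (simp add: f_def)
    qed
    then show ?thesis by auto
  qed
  have "fact (card (f ` box T)) \<le> (real S * (1 + e) * (real (2 * T) * y)) ^ card (f ` box T)
      * real (card I) ^ 2 * real B ^ 3"
  proof (rule exp_values_bound)
    show "finite I" by (simp add: I_def)
    show "I \<noteq> {}" using s by (simp add: I_def S_def lessThan_empty_iff)
    \<comment> \<open>Irrationality of \<open>e\<close> keeps the exponents \<open>m + n * e\<close>
      apart.\<close>
    show "inj_on x I"
    proof -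
      have "m = m' \<and> n = n'" if "real m + real n * e = real m' + real n' * e" for m n m' n'
      proof -
        have eq: "(real n - real n') * e = real m' - real m" using that by (simp add: algebra_simps)
        have "n = n'"
        proof (rule ccontr)
          assume "n \<noteq> n'"
          then have "e = (real m' - real m) / (real n - real n')" using eq by (simp add: field_simps)
          then show False using e(1) by (metis Rats_diff Rats_divide Rats_of_nat)
        qed
        then show ?thesis using that by simp
      qed
      then show ?thesis by (auto simp: inj_on_def x_def)
    qed
    show "0 \<le> x i \<and> x i \<le> real S * (1 + e)" if "i \<in> I" for i
      using that e by (auto simp: x_def I_def distrib_left intro!: add_mono mult_right_mono)
    show "finite (f ` box T)" "finite (f ` box (2 * T))" by (simp_all add: box_def)
    show "f ` box (2 * T) \<subseteq> {0..real (2 * T) * y}" by (rule range)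
    then show "f ` box T \<subseteq> {0..real (2 * T) * y}" using sub by blast
    show "2 * card (f ` box T) \<le> card I" "card I \<le> card (f ` box (2 * T))" by (simp_all add: cards)
    have le': "w \<tau> \<le> H ^ (2 * T)" "U \<tau> \<le> H ^ (2 * T)" "V \<tau> \<le> H ^ (2 * T)" if "\<tau> \<in> box (2 * T)" for \<tau>
      using that le by (auto simp: box_def)
    show "1 \<le> val t \<and> val t \<le> B" if "t \<in> f ` box T \<union> f ` box (2 * T)" for t
    proof -
      from that sub obtain \<tau> where \<tau>: "\<tau> \<in> box (2 * T)" "t = f \<tau>" by blast
      then have [simp]: "inv f t = \<tau>" using \<open>inj f\<close> by simp
      have "V \<tau> ^ S \<le> (H ^ (2 * T)) ^ S" using le'[OF \<tau>(1)] by (intro power_mono) auto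
      also have "\<dots> \<le> B" unfolding B_def power_mult[symmetric] using H1 by (intro power_increasing) auto
      finally show ?thesis using pos(3)[of \<tau>] by (simp add: val_def Suc_le_eq)
    qed
    show "real (val t) * exp (x i * t) = real (A t i) \<and> A t i \<le> B"
      if "t \<in> f ` box T \<union> f ` box (2 * T)" "i \<in> I" for t i
    proof -
      from that sub obtain \<tau> where \<tau>: "\<tau> \<in> box (2 * T)" "t = f \<tau>" by blast
      then have inv: "inv f t = \<tau>" using \<open>inj f\<close> by simp
      obtain m n where mn: "i = (m, n)" "m < S" "n < S" using \<open>i \<in> I\<close> by (auto simp: I_def)
      have wp: "0 < real (w \<tau>)" "0 < real (V \<tau>)" using pos[of \<tau>] by auto
      have "exp (x i * t) = exp (real m * ln (w \<tau>)) * exp (real n * (e * ln (w \<tau>)))"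
        by (simp add: mn x_def \<tau> f_def distrib_right exp_add mult.assoc)
      also have "\<dots> = real (w \<tau>) ^ m * (real (w \<tau>) powr e) ^ n"
        using wp by (simp add: exp_of_nat_mult powr_def)
      also have "\<dots> = real (w \<tau>) ^ m * real (U \<tau>) ^ n / real (V \<tau>) ^ n"
        by (simp add: powr power_divide)
      finally have "real (val t) * exp (x i * t)
          = real (w \<tau>) ^ m * real (U \<tau>) ^ n * (real (V \<tau>) ^ S / real (V \<tau>) ^ n)"
        by (simp add: val_def inv)
      also have "real (V \<tau>) ^ S / real (V \<tau>) ^ n = real (V \<tau>) ^ (S - n)"
        using mn wp by (simp add: power_diff)
      finally have 1: "real (val t) * exp (x i * t) = real (A t i)" by (simp add: A_def mn inv)
      have "A t i \<le> (H ^ (2 * T)) ^ m * (H ^ (2 * T)) ^ n * (H ^ (2 * T)) ^ (S - n)"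
        unfolding A_def mn inv prod.case using le'[OF \<tau>(1)] by (intro mult_mono power_mono) auto
      also have "\<dots> = H ^ (2 * T * (m + n + (S - n)))" by (simp only: power_add power_mult)
      also have "\<dots> \<le> B" unfolding B_def using H1 mn by (intro power_increasing mult_left_mono) auto
      finally show ?thesis using 1 by simp
    qed
    have "exp (real S * (1 + e) * (real (2 * T) * y)) = exp (real (2 * T * S) * ((1 + e) * y))"
      by (simp add: algebra_simps)
    also have "\<dots> = exp ((1 + e) * y) ^ (2 * T * S)" by (rule exp_of_nat_mult)
    also have "\<dots> \<le> real H ^ (2 * T * S)" using H by (intro power_mono) auto
    also have "\<dots> \<le> real H ^ (2 * T * (2 * S))" using H1 by (intro power_increasing) auto
    finally show "exp (real S * (1 + e) * (real (2 * T) * y)) \<le> real B" by (simp add: B_def)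
  qed
  also have "real S * (1 + e) * (real (2 * T) * y) = K * real s ^ 5"
    by (simp add: S_def T_def K_def eval_nat_numeral)
  also have "B = H ^ (32 * s ^ 5)"
    unfolding B_def S_def T_def by (rule arg_cong[where f = "power H"]) (simp flip: power_add)
  finally show False using s(2) by (simp add: cards)
qed

section \<open>The function $F$ and the exponents of a CA number\<close>

lemma powsum_ge:
  fixes x :: real
  assumes "1 \<le> x" "1 \<le> k"
  shows "x \<le> (\<Sum>j=1..k. x ^ j)" "real k \<le> (\<Sum>j=1..k. x ^ j)"
proof -
  have "(\<Sum>j\<in>{1}. x ^ j) \<le> (\<Sum>j=1..k. x ^ j)" using assms by (intro sum_mono2) auto
  then show "x \<le> (\<Sum>j=1..k. x ^ j)" by simp
  have "(\<Sum>j=1..k. 1) \<le> (\<Sum>j=1..k. x ^ j)" using assms by (intro sum_mono) auto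
  then show "real k \<le> (\<Sum>j=1..k. x ^ j)" by simp
qed

lemma ca_F_pos:
  assumes "1 < x" "1 \<le> k"
  shows "0 < ca_F x k"
proof -
  have "0 < (\<Sum>j=1..k. x ^ j)" using powsum_ge(1)[of x k] assms by linarith
  then show ?thesis using assms by (auto simp: ca_F_def intro!: divide_pos_pos ln_gt_zero)
qed

lemma ca_F_less_x:
  assumes "1 < x" "x < y" "1 \<le> k"
  shows "ca_F y k < ca_F x k"
proof -
  have sx: "0 < (\<Sum>j=1..k. x ^ j)" using powsum_ge(1)[of x k] assms by linarith
  have "(\<Sum>j=1..k. x ^ j) < (\<Sum>j=1..k. y ^ j)"
    using assms by (intro sum_strict_mono power_strict_mono) auto
  then have "ln (1 + 1 / (\<Sum>j=1..k. y ^ j)) < ln (1 + 1 / (\<Sum>j=1..k. x ^ j))"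
    using sx by (subst ln_less_cancel_iff) (auto simp: add_pos_pos intro!: divide_strict_left_mono mult_pos_pos)
  moreover have "0 < ln (1 + 1 / (\<Sum>j=1..k. x ^ j))" using sx by (intro ln_gt_zero) simp
  moreover have "0 < ln x" "ln x < ln y" using assms by auto
  ultimately show ?thesis unfolding ca_F_def
    using sx \<open>(\<Sum>j=1..k. x ^ j) < (\<Sum>j=1..k. y ^ j)\<close> by (intro frac_less) (auto intro!: ln_ge_zero)
qed

lemma ca_F_less_k:
  assumes "1 < x" "1 \<le> k" "k < l"
  shows "ca_F x l < ca_F x k"
proof -
  have sx: "0 < (\<Sum>j=1..k. x ^ j)" using powsum_ge(1)[of x k] assms by linarith
  have "(\<Sum>j=1..k. x ^ j) < (\<Sum>j=1..l. x ^ j)"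
    using assms by (intro sum_strict_mono2[of _ _ l]) auto
  then have "ln (1 + 1 / (\<Sum>j=1..l. x ^ j)) < ln (1 + 1 / (\<Sum>j=1..k. x ^ j))"
    using sx by (subst ln_less_cancel_iff) (auto simp: add_pos_pos intro!: divide_strict_left_mono mult_pos_pos)
  then show ?thesis unfolding ca_F_def using assms by (intro divide_strict_right_mono) auto
qed

lemma ca_F_le_x: "1 < x \<Longrightarrow> x \<le> y \<Longrightarrow> 1 \<le> k \<Longrightarrow> ca_F y k \<le> ca_F x k"
  using ca_F_less_x[of x y k] by (cases "x = y") auto

lemma ca_F_le_k: "1 < x \<Longrightarrow> 1 \<le> k \<Longrightarrow> k \<le> l \<Longrightarrow> ca_F x l \<le> ca_F x k"
  using ca_F_less_k[of x k l] by (cases "k = l") auto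

text \<open>From \<open>ln (1 + t) \<le> t\<close> and \<open>ln x \<ge> ln 2\<close>. The value is
  small once either argument is large, so only finitely many pairs of a prime and an index give a
  value above a positive threshold.\<close>

lemma ca_F_upper:
  assumes "2 \<le> x" "1 \<le> k"
  shows "ca_F x k \<le> 1 / (x * ln 2)" "ca_F x k \<le> 1 / (real k * ln 2)"
proof -
  have *: "ca_F x k \<le> 1 / (c * ln 2)" if c: "0 < c" "c \<le> (\<Sum>j=1..k. x ^ j)" for c :: real
  proof -
    have "ln (1 + 1 / (\<Sum>j=1..k. x ^ j)) \<le> 1 / (\<Sum>j=1..k. x ^ j)"
      using c by (intro ln_add_one_self_le_self) simp
    also have "\<dots> \<le> 1 / c" using c by (intro divide_left_mono mult_pos_pos) auto
    finally have "ca_F x k \<le> (1 / c) / ln 2"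
      unfolding ca_F_def using assms c by (intro frac_le) auto
    then show ?thesis by simp
  qed
  show "ca_F x k \<le> 1 / (x * ln 2)" "ca_F x k \<le> 1 / (real k * ln 2)"
    using assms powsum_ge[of x k] by (intro *; auto)+
qed

lemma ca_F_less_of_gt:
  assumes "0 < e" "2 \<le> x" "1 \<le> k" "1 / (e * ln 2) < x \<or> 1 / (e * ln 2) < real k"
  shows "ca_F x k < e"
proof -
  have *: "1 / (c * ln 2) < e" if "1 / (e * ln 2) < c" for c
  proof -
    have "0 < 1 / (e * ln 2)" using assms by simp
    then have "0 < c" using that by linarith
    then show ?thesis using that assms(1) by (simp add: field_simps)
  qed
  show ?thesis using assms(4) *[of x] *[of "real k"] ca_F_upper[OF assms(2,3)] by linarith
qed

text \<open>Existence by the intermediate value theorem, uniqueness by strict monotonicity in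
  \<open>x\<close>. This makes the description in \<open>ca_x\<close> meaningful.\<close>

lemma ca_F_solution_unique:
  assumes "0 < e" "1 \<le> k"
  shows "\<exists>!x. 1 < x \<and> ca_F x k = e"
proof (rule ex_ex1I)
  define C where "C = (\<Sum>j=1..k. (2::real) ^ j)"
  have C: "0 < C" using powsum_ge(1)[of 2 k] assms by (simp add: C_def)
  \<comment> \<open>Since \<open>a \<le> 2\<close>, its power sum is at most \<open>C\<close>; the
    second bound on \<open>ln a\<close> then gives \<open>e \<le> ca_F a k\<close>. The point
    \<open>b\<close> lies beyond the threshold of \<open>ca_F_less_of_gt\<close>.\<close>
  define a where "a = exp (min (ln 2) (ln (1 + 1 / C) / e))"
  define b where "b = max 2 (1 / (e * ln 2) + 1)"
  have "0 < ln (1 + 1 / C)" using C by (intro ln_gt_zero) simp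
  then have a1: "1 < a" using assms by (simp add: a_def)
  have "a \<le> exp (ln 2)" unfolding a_def by (subst exp_le_cancel_iff) simp
  then have a2: "a \<le> 2" by simp
  have lna: "0 < ln a" "ln a \<le> ln (1 + 1 / C) / e" using a1 by (simp_all add: a_def)
  have Ca: "(\<Sum>j=1..k. a ^ j) \<le> C" unfolding C_def using a1 a2 by (intro sum_mono power_mono) auto
  have sa: "0 < (\<Sum>j=1..k. a ^ j)" using powsum_ge(1)[of a k] a1 assms by linarith
  have "e * ln a \<le> ln (1 + 1 / C)" using lna assms by (simp add: field_simps)
  also have "\<dots> \<le> ln (1 + 1 / (\<Sum>j=1..k. a ^ j))"
    using Ca sa C by (subst ln_le_cancel_iff) (auto simp: add_pos_pos intro!: divide_left_mono mult_pos_pos)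
  finally have 1: "e \<le> ca_F a k" using lna by (simp add: ca_F_def field_simps)
  have 2: "ca_F b k \<le> e"
    by (rule less_imp_le, rule ca_F_less_of_gt) (use assms in \<open>auto simp: b_def\<close>)
  have "a \<le> b" using a2 by (simp add: b_def)
  have cont: "\<forall>x. a \<le> x \<and> x \<le> b \<longrightarrow> isCont (\<lambda>x. ca_F x k) x"
  proof (intro allI impI)
    fix x assume "a \<le> x \<and> x \<le> b"
    then have x: "1 < x" using a1 by simp
    have "0 < (\<Sum>j=1..k. x ^ j)" using powsum_ge(1)[of x k] x assms by linarith
    then have "0 < 1 + 1 / (\<Sum>j=1..k. x ^ j)" "(\<Sum>j=1..k. x ^ j) \<noteq> 0" by (auto intro: add_pos_pos)
    then show "isCont (\<lambda>x. ca_F x k) x" unfolding ca_F_def using x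
      by (intro continuous_intros) auto
  qed
  from IVT2[OF 2 1 \<open>a \<le> b\<close> cont] obtain x where "a \<le> x" "ca_F x k = e" by blast
  then show "\<exists>x. 1 < x \<and> ca_F x k = e" using a1 by (intro exI[of _ x]) auto
next
  fix x y assume "1 < x \<and> ca_F x k = e" "1 < y \<and> ca_F y k = e"
  then show "x = y" using ca_F_less_x[of x y k] ca_F_less_x[of y x k] assms
    by (cases x y rule: linorder_cases) auto
qed

text \<open>Monotonicity of \<open>ca_F\<close> in its first argument turns comparisons with the
  root into comparisons of values, which rids the exponents of \<open>ca_x\<close>.\<close>

lemma le_ca_x_iff:
  assumes "0 < e" "1 \<le> k" "1 < x"
  shows "x \<le> ca_x e k \<longleftrightarrow> e \<le> ca_F x k"
proof -
  have "1 < ca_x e k \<and> ca_F (ca_x e k) k = e"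
    unfolding ca_x_def by (rule theI') (rule ca_F_solution_unique[OF assms(1,2)])
  then show ?thesis
    using ca_F_le_x[of x "ca_x e k" k] ca_F_less_x[of "ca_x e k" x k] assms by force
qed

lemma prime_real_gt_1: "prime p \<Longrightarrow> 1 < real p" "prime p \<Longrightarrow> 2 \<le> real p" for p :: nat
  using prime_ge_2_nat[of p] by linarith+

text \<open>As \<open>ca_F (real p)\<close> decreases with its index, the exponent is the last index
  at which the value is still at least \<open>e\<close>, or 0 if there is none; the latter is the
  branch \<open>real p > ca_x e 1\<close> of the definition.\<close>

lemma ca_exponent_eqI:
  assumes e: "0 < e" and p: "prime p"
    and a: "a = 0 \<or> e \<le> ca_F (real p) a" "ca_F (real p) (Suc a) < e"
  shows "ca_exponent e p = a"
proof -
  note p1 = prime_real_gt_1(1)[OF p]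
  show ?thesis
  proof (cases "a = 0")
    case True
    then have "\<not> real p \<le> ca_x e 1" using le_ca_x_iff[OF e _ p1, of 1] a by simp
    then show ?thesis using True by (simp add: ca_exponent_def)
  next
    case False
    have "e \<le> ca_F (real p) 1" using a False ca_F_le_k[OF p1, of 1 a] by simp
    then have "\<not> ca_x e 1 < real p" using le_ca_x_iff[OF e _ p1, of 1] by simp
    then have "ca_exponent e p = (THE k. k \<ge> 1 \<and> ca_x e (k + 1) < real p \<and> real p \<le> ca_x e k)"
      by (simp add: ca_exponent_def)
    also have "\<dots> = (THE k. k \<ge> 1 \<and> ca_F (real p) (k + 1) < e \<and> e \<le> ca_F (real p) k)"
      using le_ca_x_iff[OF e _ p1] by (intro arg_cong[where f = The] ext) (auto simp flip: not_le)
    also have "\<dots> = a"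
    proof (rule the_equality)
      fix k assume k: "k \<ge> 1 \<and> ca_F (real p) (k + 1) < e \<and> e \<le> ca_F (real p) k"
      then show "k = a" using a False ca_F_le_k[OF p1, of "k + 1" a] ca_F_le_k[OF p1, of "Suc a" k]
        by (cases k a rule: linorder_cases) auto
    qed (use a False in auto)
    finally show ?thesis .
  qed
qed

lemma ca_exponent_props:
  assumes e: "0 < e" and p: "prime p"
  shows "ca_exponent e p = 0 \<or> e \<le> ca_F (real p) (ca_exponent e p)"
    "ca_F (real p) (Suc (ca_exponent e p)) < e"
proof -
  obtain n :: nat where n: "1 / (e * ln 2) < real n" using reals_Archimedean2 by blast
  then have ex: "ca_F (real p) (Suc n) < e"
    by (intro ca_F_less_of_gt[OF e prime_real_gt_1(2)[OF p]]) auto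
  define a where "a = (LEAST a. ca_F (real p) (Suc a) < e)"
  have 1: "ca_F (real p) (Suc a) < e" unfolding a_def by (rule LeastI[of _ n]) (rule ex)
  have 2: "a = 0 \<or> e \<le> ca_F (real p) a"
  proof (cases a)
    case (Suc b)
    then have "\<not> ca_F (real p) (Suc b) < e" using not_less_Least[of b "\<lambda>a. ca_F (real p) (Suc a) < e"]
      by (simp add: a_def)
    then show ?thesis using Suc by simp
  qed simp
  have "ca_exponent e p = a" by (rule ca_exponent_eqI[OF e p 2 1])
  then show "ca_exponent e p = 0 \<or> e \<le> ca_F (real p) (ca_exponent e p)"
    "ca_F (real p) (Suc (ca_exponent e p)) < e" using 1 2 by auto
qed

lemma finite_primes_le_real: "finite {p :: nat. prime p \<and> real p \<le> x}"
  by (rule finite_subset[of _ "{..nat \<lfloor>x\<rfloor>}"]) (auto simp: le_nat_floor)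

lemma ca_exponent_eq_0: "ca_x e 1 < real p \<Longrightarrow> ca_exponent e p = 0"
  by (simp add: ca_exponent_def)

lemma multiplicity_ca_number:
  assumes p: "prime p"
  shows "multiplicity p (ca_number e) = ca_exponent e p"
  unfolding ca_number_def using p ca_exponent_eq_0[of e p]
  by (subst multiplicity_prod_prime_powers) (auto simp: finite_primes_le_real not_le)

lemma ca_number_pos: "0 < ca_number e"
  unfolding ca_number_def by (auto intro!: prod_pos simp: prime_gt_0_nat)

text \<open>Enlarging the index set lets two CA numbers be written as products over the same primes
  and compared factor by factor.\<close>

lemma ca_number_eq_prod:
  assumes "finite A" "\<And>p. p \<in> A \<Longrightarrow> prime p" "\<And>p. prime p \<Longrightarrow> real p \<le> ca_x e 1 \<Longrightarrow> p \<in> A"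
  shows "ca_number e = (\<Prod>p\<in>A. p ^ ca_exponent e p)"
  unfolding ca_number_def
  by (rule prod.mono_neutral_left) (use assms ca_exponent_eq_0[of e] in \<open>auto simp: not_le\<close>)

section \<open>The enumeration of the parameters\<close>

lemma finite_ca_E_greater:
  assumes "0 < e"
  shows "finite {e' \<in> ca_E. e < e'}"
proof -
  define n where "n = nat \<lceil>1 / (e * ln 2)\<rceil>"
  have "{e' \<in> ca_E. e < e'} \<subseteq> (\<lambda>(p, k). ca_F (real p) k) ` ({..n} \<times> {..n})"
  proof
    fix e' assume "e' \<in> {e' \<in> ca_E. e < e'}"
    then obtain p k where pk: "e' = ca_F (real p) k" "prime p" "1 \<le> k" "e < ca_F (real p) k"
      by (auto simp: ca_E_def)
    then have "real p \<le> 1 / (e * ln 2)" "real k \<le> 1 / (e * ln 2)"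
      using ca_F_less_of_gt[OF assms prime_real_gt_1(2)[OF pk(2)] pk(3)] by (auto simp flip: not_less)
    then have "p \<le> n" "k \<le> n" unfolding n_def by linarith+
    then show "e' \<in> (\<lambda>(p, k). ca_F (real p) k) ` ({..n} \<times> {..n})" using pk by auto
  qed
  then show ?thesis by (rule finite_subset) auto
qed

lemma ca_E_pos: "e \<in> ca_E \<Longrightarrow> 0 < e"
  by (auto simp: ca_E_def intro!: ca_F_pos prime_real_gt_1)

lemma infinite_ca_E: "infinite ca_E"
proof -
  have "inj (\<lambda>k. ca_F 2 (Suc k))"
  proof (rule injI)
    fix k l assume "ca_F 2 (Suc k) = ca_F 2 (Suc l)"
    then show "k = l" using ca_F_less_k[of 2 "Suc k" "Suc l"] ca_F_less_k[of 2 "Suc l" "Suc k"]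
      by (cases k l rule: linorder_cases) auto
  qed
  then have "infinite (range (\<lambda>k. ca_F 2 (Suc k)))" using finite_imageD by blast
  moreover have "ca_F 2 (Suc k) \<in> ca_E" for k
    unfolding ca_E_def by (intro CollectI exI[of _ 2] exI[of _ "Suc k"]) auto
  then have "range (\<lambda>k. ca_F 2 (Suc k)) \<subseteq> ca_E" by blast
  ultimately show ?thesis using finite_subset by blast
qed

text \<open>Only finitely many elements lie above a given \<open>e\<close>, so some \<open>g\<close>
  lies below it, and the maximum of the finite set of elements from \<open>g\<close> up to but
  excluding \<open>e\<close> comes next. For uniqueness, a smaller element has strictly more
  elements above it.\<close>

lemma decreasing_enumeration:
  fixes S :: "'a :: linorder set"
  assumes inf: "infinite S" and fin: "\<And>e. e \<in> S \<Longrightarrow> finite {e' \<in> S. e < e'}"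
  shows "\<exists>!e. e \<in> S \<and> finite {e' \<in> S. e < e'} \<and> card {e' \<in> S. e < e'} = n"
proof (rule ex_ex1I)
  show "\<exists>e. e \<in> S \<and> finite {e' \<in> S. e < e'} \<and> card {e' \<in> S. e < e'} = n"
  proof (induction n)
    case 0
    obtain g where g: "g \<in> S" using inf by fastforce
    define M where "M = Max (insert g {e' \<in> S. g < e'})"
    have "M \<in> insert g {e' \<in> S. g < e'}" unfolding M_def using fin[OF g] by (intro Max_in) auto
    have "e' \<le> M" if "e' \<in> S" for e'
      using fin[OF g] that unfolding M_def by (cases "g < e'") (auto intro: Max_ge simp: Max_ge_iff not_less)
    then have "{e' \<in> S. M < e'} = {}" by (auto simp flip: not_le)
    then have "finite {e' \<in> S. M < e'} \<and> card {e' \<in> S. M < e'} = 0" by (simp only: card.empty finite.emptyI simp_thms)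
    moreover have "M \<in> S" using g \<open>M \<in> insert g {e' \<in> S. g < e'}\<close> by auto
    ultimately show ?case by blast
  next
    case (Suc n)
    then obtain e where e: "e \<in> S" "card {e' \<in> S. e < e'} = n" by blast
    have "\<exists>g\<in>S. g < e"
    proof (rule ccontr)
      assume "\<not> ?thesis"
      then have "S \<subseteq> insert e {e' \<in> S. e < e'}" by force
      then show False using inf fin[OF e(1)] finite_subset by blast
    qed
    then obtain g where g: "g \<in> S" "g < e" by blast
    define R where "R = {h \<in> S. g \<le> h \<and> h < e}"
    have "R \<subseteq> insert g {e' \<in> S. g < e'}" by (auto simp: R_def)
    then have finR: "finite R" using fin[OF g(1)] finite_subset by blast
    have "g \<in> R" using g by (simp add: R_def)
    define M where "M = Max R"
    have M: "M \<in> R" unfolding M_def using finR \<open>g \<in> R\<close> by (intro Max_in) auto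
    have max: "h \<le> M" if "h \<in> R" for h unfolding M_def using finR that by simp
    have "{e' \<in> S. M < e'} = insert e {e' \<in> S. e < e'}"
    proof (intro equalityI subsetI)
      fix h assume h: "h \<in> {e' \<in> S. M < e'}"
      then have "h \<notin> R" "g \<le> h" using max[of h] max[OF \<open>g \<in> R\<close>] by auto
      then show "h \<in> insert e {e' \<in> S. e < e'}" using h by (auto simp: R_def)
    qed (use M e in \<open>auto simp: R_def\<close>)
    then have "card {e' \<in> S. M < e'} = Suc n" using e fin[OF e(1)] by simp
    then show ?case using M fin by (intro exI[of _ M]) (auto simp: R_def)
  qed
next
  fix e f
  assume ef: "e \<in> S \<and> finite {e' \<in> S. e < e'} \<and> card {e' \<in> S. e < e'} = n"
    "f \<in> S \<and> finite {e' \<in> S. f < e'} \<and> card {e' \<in> S. f < e'} = n"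
  have *: "card {e' \<in> S. y < e'} < card {e' \<in> S. x < e'}" if "x < y" "x \<in> S" "y \<in> S" for x y
    using that fin by (intro psubset_card_mono) auto
  show "e = f" using *[of e f] *[of f e] ef by (cases e f rule: linorder_cases) auto
qed

lemma ca_eps_props:
  "ca_eps i \<in> ca_E" "card {e' \<in> ca_E. ca_eps i < e'} = i - 1"
proof -
  have "ca_eps i \<in> ca_E \<and> finite {e' \<in> ca_E. ca_eps i < e'} \<and> card {e' \<in> ca_E. ca_eps i < e'} = i - 1"
    unfolding ca_eps_def
    by (rule theI'[OF decreasing_enumeration[OF infinite_ca_E]]) (intro finite_ca_E_greater ca_E_pos)
  then show "ca_eps i \<in> ca_E" "card {e' \<in> ca_E. ca_eps i < e'} = i - 1" by auto
qed

lemma ca_eps_pos: "0 < ca_eps i"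
  using ca_E_pos ca_eps_props(1) .

text \<open>The index starts at 1 because truncated subtraction gives the indices 0 and 1 the same
  number of larger elements.\<close>

lemma ca_eps_Suc_less:
  assumes "1 \<le> i"
  shows "ca_eps (Suc i) < ca_eps i"
proof (rule ccontr)
  assume "\<not> ?thesis"
  then have "card {e' \<in> ca_E. ca_eps (Suc i) < e'} \<le> card {e' \<in> ca_E. ca_eps i < e'}"
    by (intro card_mono finite_ca_E_greater ca_eps_pos) auto
  then show False using assms by (simp add: ca_eps_props)
qed

text \<open>Otherwise \<open>e\<close>, \<open>ca_eps i\<close> and the \<open>i - 1\<close>
  elements above it would be \<open>i + 1\<close> elements above \<open>ca_eps (Suc i)\<close>,
  which has only \<open>i\<close>.\<close>

lemma ca_eps_no_between:
  assumes "1 \<le> i" "e \<in> ca_E" "e < ca_eps i"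
  shows "e \<le> ca_eps (Suc i)"
proof (rule ccontr)
  assume c: "\<not> ?thesis"
  have fin: "finite {e' \<in> ca_E. ca_eps i < e'}" by (intro finite_ca_E_greater ca_eps_pos)
  have "card (insert e (insert (ca_eps i) {e' \<in> ca_E. ca_eps i < e'}))
      \<le> card {e' \<in> ca_E. ca_eps (Suc i) < e'}"
    using c assms ca_eps_Suc_less[OF assms(1)]
    by (intro card_mono finite_ca_E_greater ca_eps_pos) (auto simp: ca_eps_props)
  moreover have "card (insert e (insert (ca_eps i) {e' \<in> ca_E. ca_eps i < e'})) = i + 1"
    using assms fin by (simp add: ca_eps_props)
  ultimately show False by (simp add: ca_eps_props)
qed

section \<open>Primes sharing a value of $F$\<close>

lemma powr_ca_F:
  assumes "1 < x" "1 \<le> k"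
  shows "x powr ca_F x k = 1 + 1 / (\<Sum>j=1..k. x ^ j)"
proof -
  have "0 < (\<Sum>j=1..k. x ^ j)" using powsum_ge(1)[of x k] assms by linarith
  then have "0 < 1 + 1 / (\<Sum>j=1..k. x ^ j)" by (intro add_pos_pos) auto
  then show ?thesis using assms by (simp add: powr_def ca_F_def)
qed

lemma powr_ca_F_nat:
  fixes q k :: nat
  assumes "prime q" "1 \<le> k"
  shows "real q powr ca_F (real q) k = real (1 + (\<Sum>j=1..k. q ^ j)) / real (\<Sum>j=1..k. q ^ j)"
    "1 \<le> (\<Sum>j=1..k. q ^ j)"
proof -
  have "1 \<le> (\<Sum>j=1..k. real q ^ j)"
    using powsum_ge(1)[of "real q" k] prime_real_gt_1[OF assms(1)] assms(2) by linarith
  then have "1 \<le> real (\<Sum>j=1..k. q ^ j)" by simp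
  then show "1 \<le> (\<Sum>j=1..k. q ^ j)" by linarith
  then show "real q powr ca_F (real q) k = real (1 + (\<Sum>j=1..k. q ^ j)) / real (\<Sum>j=1..k. q ^ j)"
    using powr_ca_F[OF prime_real_gt_1(1)[OF assms(1)] assms(2)] \<open>1 \<le> real (\<Sum>j=1..k. q ^ j)\<close>
    by (simp add: add_divide_distrib)
qed

text \<open>A value \<open>m / n\<close> would give \<open>(1 + S) ^ n = q ^ m * S ^ n\<close> for
  the power sum \<open>S\<close>. Since \<open>q\<close> divides \<open>S\<close> and
  \<open>n\<close> is positive, \<open>q\<close> divides the right side, hence \<open>1 + S\<close>,
  hence 1.\<close>

lemma ca_F_irrational:
  fixes q k :: nat
  assumes "prime q" "1 \<le> k"
  shows "ca_F (real q) k \<notin> \<rat>"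
proof
  define S where "S = (\<Sum>j=1..k. q ^ j)"
  note q1 = prime_real_gt_1(1)[OF assms(1)]
  assume "ca_F (real q) k \<in> \<rat>"
  then obtain m n :: nat where mn: "n \<noteq> 0" "\<bar>ca_F (real q) k\<bar> = real m / real n"
    using Rats_abs_nat_div_natE by metis
  then have e: "ca_F (real q) k = real m / real n" using ca_F_pos[OF q1 assms(2)] by simp
  have S: "real q powr ca_F (real q) k = real (1 + S) / real S" "1 \<le> S"
    using powr_ca_F_nat[OF assms] by (simp_all add: S_def)
  have "(real q powr ca_F (real q) k) ^ n = real q powr real m"
    using q1 mn(1) by (simp add: e powr_powr flip: powr_realpow)
  also have "\<dots> = real q ^ m" using q1 by (simp add: powr_realpow)
  finally have "real ((1 + S) ^ n) = real (q ^ m * S ^ n)"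
    using S by (simp add: power_divide field_simps)
  then have eq: "(1 + S) ^ n = q ^ m * S ^ n" by (simp only: of_nat_eq_iff)
  have dS: "q dvd S" unfolding S_def by (intro dvd_sum dvd_power) auto
  then have "q dvd q ^ m * S ^ n" using mn(1) by (intro dvd_mult dvd_trans[OF dS] dvd_power) auto
  then have "q dvd 1 + S" using eq assms(1) prime_dvd_power by metis
  then have "q dvd 1" using dS dvd_add_left_iff by blast
  then show False using assms(1) not_prime_unit by blast
qed

text \<open>Multiplicities recover the exponents; this is the multiplicative independence needed in
  \<open>six_exponentials_rational\<close>.\<close>

lemma inj_three_prime_powers:
  fixes p q r :: nat
  assumes "prime p" "prime q" "prime r" "p \<noteq> q" "p \<noteq> r" "q \<noteq> r"
  shows "inj (\<lambda>(a, b, c). p ^ a * q ^ b * r ^ c)"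
proof -
  have m: "multiplicity p (p ^ a * q ^ b * r ^ c) = a" "multiplicity q (p ^ a * q ^ b * r ^ c) = b"
    "multiplicity r (p ^ a * q ^ b * r ^ c) = c" for a b c
    using assms by (simp_all add: prime_elem_multiplicity_mult_distrib multiplicity_distinct_prime_power)
  show ?thesis
    by (rule inj_on_inverseI[where g = "\<lambda>n. (multiplicity p n, multiplicity q n, multiplicity r n)"])
      (auto simp: m)
qed

theorem ca_F_not_three_primes:
  fixes p q r :: nat
  assumes "prime p" "prime q" "prime r" "p \<noteq> q" "p \<noteq> r" "q \<noteq> r" "1 \<le> k" "1 \<le> l" "1 \<le> m"
    and "ca_F (real p) k = e" "ca_F (real q) l = e" "ca_F (real r) m = e"
  shows False
proof (rule six_exponentials_rational[of e p q r])
  show "e \<notin> \<rat>" using ca_F_irrational assms by blast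
  show "0 \<le> e" using ca_F_pos[OF prime_real_gt_1(1), of p k] assms by simp
  show "1 \<le> p" "1 \<le> q" "1 \<le> r" using assms prime_ge_1_nat by auto
  show "inj (\<lambda>(a, b, c). p ^ a * q ^ b * r ^ c)" using assms by (intro inj_three_prime_powers)
  show "real p powr e = real (1 + (\<Sum>j=1..k. p ^ j)) / real (\<Sum>j=1..k. p ^ j)"
    "real q powr e = real (1 + (\<Sum>j=1..l. q ^ j)) / real (\<Sum>j=1..l. q ^ j)"
    "real r powr e = real (1 + (\<Sum>j=1..m. r ^ j)) / real (\<Sum>j=1..m. r ^ j)"
    using powr_ca_F_nat(1) assms by metis+
  show "1 \<le> (\<Sum>j=1..k. p ^ j)" "1 \<le> (\<Sum>j=1..l. q ^ j)" "1 \<le> (\<Sum>j=1..m. r ^ j)"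
    using powr_ca_F_nat(2) assms by metis+
qed

section \<open>Multiplying by primes\<close>

text \<open>A divisor of \<open>q ^ Suc a * m\<close> either divides \<open>q ^ a * m\<close> or is
  \<open>q ^ Suc a\<close> times a divisor of \<open>m\<close>.\<close>

lemma sigma_prime_power_Suc_mult:
  assumes q: "prime q" and m: "\<not> q dvd m" "0 < m"
  shows "sigma (q ^ Suc a * m) = sigma (q ^ a * m) + q ^ Suc a * sigma m"
proof -
  have eq: "{d. d dvd q ^ Suc a * m} = {d. d dvd q ^ a * m} \<union> (\<lambda>d. q ^ Suc a * d) ` {d. d dvd m}"
  proof (intro equalityI subsetI)
    fix d assume "d \<in> {d. d dvd q ^ Suc a * m}"
    then obtain b c where bc: "d = b * c" "b dvd q ^ Suc a" "c dvd m"
      using division_decomp[of d "q ^ Suc a" m] by auto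
    then obtain i where i: "i \<le> Suc a" "b = q ^ i" using divides_primepow_nat[OF q] by blast
    show "d \<in> {d. d dvd q ^ a * m} \<union> (\<lambda>d. q ^ Suc a * d) ` {d. d dvd m}"
    proof (cases "i = Suc a")
      case False
      then have "b dvd q ^ a" using i by (simp add: le_imp_power_dvd)
      then show ?thesis using bc by (simp add: mult_dvd_mono)
    qed (use bc i in auto)
  next
    fix d assume "d \<in> {d. d dvd q ^ a * m} \<union> (\<lambda>d. q ^ Suc a * d) ` {d. d dvd m}"
    then show "d \<in> {d. d dvd q ^ Suc a * m}"
      by (auto simp: mult_dvd_mono mult.assoc intro: dvd_mult)
  qed
  have disj: "{d. d dvd q ^ a * m} \<inter> (\<lambda>d. q ^ Suc a * d) ` {d. d dvd m} = {}"
  proof -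
    have False if "q ^ Suc a * d dvd q ^ a * m" for d
    proof -
      have "q ^ a * (q * d) dvd q ^ a * m" using that by (simp add: mult_ac)
      then have "q * d dvd m" using q by (simp add: prime_gt_0_nat)
      then show False using m dvd_mult_left by blast
    qed
    then show ?thesis by blast
  qed
  have fin: "finite {d. d dvd q ^ a * m}" "finite {d. d dvd m}"
    using m q by (auto intro!: finite_divisors_nat simp: prime_gt_0_nat)
  have "inj_on (\<lambda>d. q ^ Suc a * d) {d. d dvd m}" using q by (auto simp: inj_on_def prime_gt_0_nat)
  then have "(\<Sum>d\<in>(\<lambda>d. q ^ Suc a * d) ` {d. d dvd m}. d) = q ^ Suc a * sigma m"
    by (subst sum.reindex) (simp_all add: sigma_def sum_distrib_left)
  then show ?thesis
    unfolding sigma_def[of "q ^ Suc a * m"] eq using fin disj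
    by (subst sum.union_disjoint) (auto simp: sigma_def)
qed

lemma sigma_prime_power_mult:
  assumes "prime q" "\<not> q dvd m" "0 < m"
  shows "sigma (q ^ a * m) = (\<Sum>j\<le>a. q ^ j) * sigma m"
  by (induction a) (use sigma_prime_power_Suc_mult[OF assms] in \<open>simp_all add: distrib_right\<close>)

text \<open>Writing \<open>n = q ^ a * m\<close> with \<open>m\<close> prime to \<open>q\<close> and
  \<open>s = 1 + q + ... + q ^ a\<close>, the gain is \<open>(1 + q * s) / (q * s)\<close>, where
  \<open>q * s\<close> is the power sum in \<open>ca_F (real q) (Suc a)\<close>.\<close>

lemma rho_prime_mult:
  assumes q: "prime q" and n: "0 < n"
  shows "rho (q * n) = rho n * real q powr ca_F (real q) (Suc (multiplicity q n))"
proof -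
  define a where "a = multiplicity q n"
  obtain m where m: "n = q ^ a * m" "\<not> q dvd m"
    using n q multiplicity_decompose'[of n q] not_prime_unit unfolding a_def by blast
  then have m0: "0 < m" using n by (cases m) auto
  note q1 = prime_real_gt_1(1)[OF q]
  define s where "s = (\<Sum>j\<le>a. real q ^ j)"
  have s1: "(\<Sum>j=1..Suc a. real q ^ j) = real q * s"
  proof -
    have "(\<Sum>j=1..Suc a. real q ^ j) = (\<Sum>j=0..a. real q ^ Suc j)"
      by (metis One_nat_def sum.shift_bounds_cl_Suc_ivl)
    then show ?thesis by (simp add: s_def sum_distrib_left atLeast0AtMost)
  qed
  have s2: "(\<Sum>j\<le>Suc a. real q ^ j) = 1 + real q * s"
    by (simp only: sum.atMost_Suc_shift) (simp add: s_def sum_distrib_left)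
  have s0: "0 < s" unfolding s_def using q1 by (intro sum_pos) auto
  have 1: "rho n = s * real (sigma m) / (real q ^ a * real m)"
    by (simp add: rho_def m sigma_prime_power_mult[OF q m(2) m0] s_def)
  have "q * n = q ^ Suc a * m" by (simp add: m)
  then have 2: "rho (q * n) = (1 + real q * s) * real (sigma m) / (real q ^ Suc a * real m)"
    by (simp only: rho_def sigma_prime_power_mult[OF q m(2) m0] flip: s2) simp
  have 3: "real q powr ca_F (real q) (Suc a) = 1 + 1 / (real q * s)"
    using powr_ca_F[OF q1, of "Suc a"] s1 by simp
  show ?thesis using s0 q1 m0 unfolding a_def[symmetric] 1 2 3 by (simp add: field_simps)
qed

text \<open>Multiplying by other primes leaves the multiplicity of \<open>q\<close> unchanged, so
  the gains accumulate; their common exponent \<open>e\<close> merges them into one power.\<close>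

lemma rho_mult_prod_primes:
  assumes "finite Q" "0 < n"
    and "\<And>q. q \<in> Q \<Longrightarrow> prime q \<and> ca_F (real q) (Suc (multiplicity q n)) = e"
  shows "rho (n * \<Prod>Q) = rho n * real (\<Prod>Q) powr e"
  using assms(1,3)
proof (induction Q rule: finite_induct)
  case (insert q Q)
  have q: "prime q" using insert.prems by blast
  have pos: "0 < \<Prod>Q" using insert.prems by (intro prod_pos) (auto simp: prime_gt_0_nat)
  have "\<not> q dvd \<Prod>Q"
  proof
    assume "q dvd \<Prod>Q"
    then obtain r where "r \<in> Q" "q dvd r" using q insert.hyps(1) by (auto simp: prime_dvd_prod_iff)
    moreover have "prime r" using insert.prems \<open>r \<in> Q\<close> by blast
    ultimately show False using insert.hyps(2) q primes_dvd_imp_eq[of q r] by blast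
  qed
  then have "multiplicity q (n * \<Prod>Q) = multiplicity q n"
    using q pos assms(2) by (simp add: prime_elem_multiplicity_mult_distrib not_dvd_imp_multiplicity_0)
  then have "rho (q * (n * \<Prod>Q)) = rho (n * \<Prod>Q) * real q powr e"
    using rho_prime_mult[OF q, of "n * \<Prod>Q"] pos assms(2) insert.prems[of q] by simp
  also have "rho (n * \<Prod>Q) = rho n * real (\<Prod>Q) powr e" using insert by blast
  finally show ?case using insert.hyps by (simp add: powr_mult mult_ac)
qed simp

section \<open>Consecutive CA numbers\<close>

definition ca_primes :: "real \<Rightarrow> nat set" where
  "ca_primes e = {q. prime q \<and> (\<exists>k\<ge>1. ca_F (real q) k = e)}"

lemma ca_primes_le:
  assumes "q \<in> ca_primes e"
  shows "e \<le> ca_F (real q) 1" "real q \<le> ca_x e 1"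
proof -
  from assms obtain k where k: "prime q" "1 \<le> k" "ca_F (real q) k = e" by (auto simp: ca_primes_def)
  note q1 = prime_real_gt_1(1)[OF k(1)]
  show "e \<le> ca_F (real q) 1" using ca_F_le_k[OF q1, of 1 k] k by simp
  then show "real q \<le> ca_x e 1" using le_ca_x_iff[of e 1 "real q"] ca_F_pos[OF q1 k(2)] k q1 by simp
qed

lemma finite_ca_primes: "finite (ca_primes e)"
  by (rule finite_subset[OF _ finite_primes_le_real[of "ca_x e 1"]])
    (use ca_primes_le(2) in \<open>auto simp: ca_primes_def simp del: One_nat_def\<close>)

lemma card_ca_primes: "card (ca_primes e) \<le> 2"
proof (rule ccontr)
  assume "\<not> ?thesis"
  then obtain P where "P \<subseteq> ca_primes e" "card P = 3"
    using obtain_subset_with_card_n[of 3 "ca_primes e"] by auto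
  then obtain p q r where "p \<noteq> q" "p \<noteq> r" "q \<noteq> r" "{p, q, r} \<subseteq> ca_primes e"
    by (auto simp: card_3_iff)
  then show False using ca_F_not_three_primes[of p q r _ _ _ e] by (auto simp: ca_primes_def)
qed

text \<open>No parameter lies between the two values, so the first value of
  \<open>ca_F (real p)\<close> below \<open>ca_eps i\<close> is at most
  \<open>ca_eps (Suc i)\<close>. Where equality holds the exponent of \<open>p\<close> rises by one;
  elsewhere it stays.\<close>

lemma ca_n_Suc:
  assumes i: "1 \<le> i"
  shows "q \<in> ca_primes (ca_eps (Suc i)) \<Longrightarrow>
      ca_F (real q) (Suc (multiplicity q (ca_n i))) = ca_eps (Suc i)"
    and "ca_n (Suc i) = ca_n i * \<Prod>(ca_primes (ca_eps (Suc i)))"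
proof -
  define e e' where "e = ca_eps i" and "e' = ca_eps (Suc i)"
  have e: "0 < e'" "0 < e" "e' < e" using ca_eps_Suc_less[OF i] by (auto simp: e_def e'_def ca_eps_pos)
  have next_le: "ca_F (real p) (Suc (ca_exponent e p)) \<le> e'" if "prime p" for p
    unfolding e'_def
  proof (rule ca_eps_no_between[OF i])
    show "ca_F (real p) (Suc (ca_exponent e p)) \<in> ca_E"
      using that unfolding ca_E_def by (intro CollectI exI conjI) auto
    show "ca_F (real p) (Suc (ca_exponent e p)) < ca_eps i"
      using ca_exponent_props(2)[OF e(2) that] by (simp add: e_def)
  qed
  have Q: "ca_F (real p) (Suc (ca_exponent e p)) = e'" if "p \<in> ca_primes e'" for p
  proof -
    from that obtain k where k: "prime p" "1 \<le> k" "ca_F (real p) k = e'" by (auto simp: ca_primes_def)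
    note p1 = prime_real_gt_1(1)[OF k(1)]
    have "\<not> k \<le> ca_exponent e p"
      using ca_exponent_props(1)[OF e(2) k(1)] ca_F_le_k[OF p1 k(2), of "ca_exponent e p"] k e by auto
    then have "ca_F (real p) k \<le> ca_F (real p) (Suc (ca_exponent e p))"
      by (intro ca_F_le_k p1) auto
    then show ?thesis using k next_le[OF k(1)] by simp
  qed
  then show "q \<in> ca_primes (ca_eps (Suc i)) \<Longrightarrow>
      ca_F (real q) (Suc (multiplicity q (ca_n i))) = ca_eps (Suc i)"
    by (simp add: ca_n_def multiplicity_ca_number e_def e'_def ca_primes_def)
  have exp: "ca_exponent e' p = ca_exponent e p + (if p \<in> ca_primes e' then 1 else 0)" if p: "prime p" for p
  proof (rule ca_exponent_eqI[OF e(1) p])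
    note p1 = prime_real_gt_1(1)[OF p]
    show "ca_exponent e p + (if p \<in> ca_primes e' then 1 else 0) = 0 \<or>
      e' \<le> ca_F (real p) (ca_exponent e p + (if p \<in> ca_primes e' then 1 else 0))"
      using Q[of p] ca_exponent_props(1)[OF e(2) p] e(3) by auto
    show "ca_F (real p) (Suc (ca_exponent e p + (if p \<in> ca_primes e' then 1 else 0))) < e'"
    proof (cases "p \<in> ca_primes e'")
      case True
      then show ?thesis using Q[of p] ca_F_less_k[OF p1, of "Suc (ca_exponent e p)" "Suc (Suc (ca_exponent e p))"] by simp
    next
      case False
      then have "ca_F (real p) (Suc (ca_exponent e p)) \<noteq> e'" using p by (auto simp: ca_primes_def)
      then show ?thesis using next_le[OF p] False by simp
    qed
  qed
  define A where "A = {p :: nat. prime p \<and> real p \<le> max (ca_x e 1) (ca_x e' 1)}"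
  have A: "finite A" "\<And>p. p \<in> A \<Longrightarrow> prime p" by (simp_all add: A_def finite_primes_le_real)
  have "ca_primes e' \<subseteq> A"
  proof
    fix p assume "p \<in> ca_primes e'"
    then show "p \<in> A" using ca_primes_le(2)[of p e'] by (auto simp: A_def ca_primes_def)
  qed
  have "ca_n (Suc i) = (\<Prod>p\<in>A. p ^ ca_exponent e' p)"
    unfolding ca_n_def e'_def[symmetric] by (intro ca_number_eq_prod A) (auto simp: A_def)
  also have "\<dots> = (\<Prod>p\<in>A. p ^ ca_exponent e p) * (\<Prod>p\<in>A. if p \<in> ca_primes e' then p else 1)"
    unfolding prod.distrib[symmetric] by (intro prod.cong refl) (simp add: exp A)
  also have "(\<Prod>p\<in>A. p ^ ca_exponent e p) = ca_n i"
    unfolding ca_n_def e_def[symmetric] by (intro ca_number_eq_prod[symmetric] A) (auto simp: A_def)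
  also have "(\<Prod>p\<in>A. if p \<in> ca_primes e' then p else 1) = \<Prod>(ca_primes e')"
    using \<open>ca_primes e' \<subseteq> A\<close> A(1) by (simp add: prod.If_cases Int_absorb1)
  finally show "ca_n (Suc i) = ca_n i * \<Prod>(ca_primes (ca_eps (Suc i)))" by (simp add: e'_def)
qed

section \<open>Comparison of the second order terms\<close>

lemma ln_one_plus_lower:
  fixes u :: real
  assumes "0 \<le> u"
  shows "u - u\<^sup>2 / 2 \<le> ln (1 + u)"
proof -
  define g where "g x = ln (1 + x) - x + x\<^sup>2 / 2" for x :: real
  have "g 0 \<le> g u"
  proof (rule DERIV_nonneg_imp_nondecreasing[OF assms])
    fix x :: real assume x: "0 \<le> x" "x \<le> u"
    have "(g has_real_derivative (1 / (1 + x) - 1 + x)) (at x)"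
      unfolding g_def using x by (auto intro!: derivative_eq_intros)
    moreover have "1 / (1 + x) - 1 + x = x\<^sup>2 / (1 + x)" using x by (simp add: field_simps power2_eq_square)
    ultimately show "\<exists>y. (g has_real_derivative y) (at x) \<and> 0 \<le> y" using x by auto
  qed
  then show ?thesis by (simp add: g_def)
qed

lemma ln_one_plus_upper:
  fixes u :: real
  assumes "0 \<le> u"
  shows "ln (1 + u) \<le> u - u\<^sup>2 / 2 + u ^ 3 / 3"
proof -
  define g where "g x = x - x\<^sup>2 / 2 + x ^ 3 / 3 - ln (1 + x)" for x :: real
  have "g 0 \<le> g u"
  proof (rule DERIV_nonneg_imp_nondecreasing[OF assms])
    fix x :: real assume x: "0 \<le> x" "x \<le> u"
    have "(g has_real_derivative (1 - x + x\<^sup>2 - 1 / (1 + x))) (at x)"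
      unfolding g_def using x by (auto intro!: derivative_eq_intros)
    moreover have "1 - x + x\<^sup>2 - 1 / (1 + x) = x ^ 3 / (1 + x)"
      using x by (simp add: field_simps power2_eq_square power3_eq_cube)
    ultimately show "\<exists>y. (g has_real_derivative y) (at x) \<and> 0 \<le> y" using x by auto
  qed
  then show ?thesis by (simp add: g_def)
qed

text \<open>The quadratic bounds for \<open>ln (1 + u)\<close> and \<open>exp\<close> are combined;
  the last term uses that the square of \<open>u - u^2 / 2\<close> is at least
  \<open>u^2 * (1 - u)\<close>.\<close>

lemma exp_mult_ln_one_plus_lower:
  fixes u y :: real
  assumes "0 \<le> u" "u \<le> 1" "0 \<le> y"
  shows "1 + y * u - y * u\<^sup>2 / 2 + y\<^sup>2 * u\<^sup>2 * (1 - u) / 2 \<le> exp (y * ln (1 + u))"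
proof -
  define b where "b = u - u\<^sup>2 / 2"
  have b0: "0 \<le> b"
  proof -
    have "u\<^sup>2 \<le> u" using assms power2_le_imp_le by (simp add: power2_eq_square mult_left_le)
    then show ?thesis using assms(1) unfolding b_def by linarith
  qed
  have "u\<^sup>2 * (1 - u) \<le> b\<^sup>2"
  proof -
    have "b\<^sup>2 = u\<^sup>2 * (1 - u) + (u\<^sup>2 / 2)\<^sup>2" by (simp add: b_def power2_eq_square field_simps)
    then show ?thesis by simp
  qed
  then have 1: "y\<^sup>2 * (u\<^sup>2 * (1 - u)) \<le> y\<^sup>2 * b\<^sup>2" by (intro mult_left_mono) auto
  have "1 + y * b + (y * b)\<^sup>2 / 2 \<le> exp (y * b)"
    using assms b0 by (intro exp_lower_Taylor_quadratic) auto
  also have "\<dots> \<le> exp (y * ln (1 + u))"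
    using ln_one_plus_lower[OF assms(1)] assms by (simp add: b_def mult_left_mono)
  finally have "1 + y * b + y\<^sup>2 * b\<^sup>2 / 2 \<le> exp (y * ln (1 + u))" by (simp add: power_mult_distrib)
  moreover have "y * b = y * u - y * u\<^sup>2 / 2" by (simp add: b_def algebra_simps)
  ultimately show ?thesis using 1 by (simp add: mult.assoc)
qed

text \<open>Splitting off \<open>ln N\<close> leaves \<open>ln (1 + l / N) / ln N\<close>, which
  decreases in \<open>N\<close>, so \<open>N\<close> may be replaced by \<open>p\<close>. With
  \<open>N = ln n\<close> the assumption \<open>p < N\<close> is the CA3 condition, and it is the
  source of the strict inequality.\<close>

lemma ln_ln_ratio_upper:
  fixes p l N :: real
  assumes "1 < p" "0 < l" "p < N"
  shows "ln (N + l) / ln N < 1 + l / ln p * (1 / p - l * (1 / p)\<^sup>2 / 2 + l\<^sup>2 * (1 / p) ^ 3 / 3)"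
proof -
  have lnp: "0 < ln p" "ln p < ln N" using assms by auto
  have "N + l = N * (1 + l / N)" using assms by (simp add: field_simps)
  moreover have "0 < 1 + l / N" using assms by (intro add_pos_pos) auto
  ultimately have "ln (N + l) = ln N + ln (1 + l / N)" using assms by (simp add: ln_mult)
  then have "ln (N + l) / ln N = 1 + ln (1 + l / N) / ln N" using lnp by (simp add: add_divide_distrib)
  also have "ln (1 + l / N) / ln N < ln (1 + l / p) / ln p"
  proof (rule frac_less)
    show "0 \<le> ln (1 + l / N)" using assms by (intro ln_ge_zero) auto
    show "ln (1 + l / N) < ln (1 + l / p)"
      using assms by (subst ln_less_cancel_iff) (auto intro!: add_pos_pos divide_strict_left_mono mult_pos_pos)
  qed (use lnp in auto)
  also have "ln (1 + l / p) / ln p \<le> (l / p - (l / p)\<^sup>2 / 2 + (l / p) ^ 3 / 3) / ln p"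
    using ln_one_plus_upper[of "l / p"] assms lnp by (intro divide_right_mono) auto
  also have "\<dots> = l / ln p * (1 / p - l * (1 / p)\<^sup>2 / 2 + l\<^sup>2 * (1 / p) ^ 3 / 3)"
    using assms lnp by (simp add: field_simps power2_eq_square power3_eq_cube)
  finally show ?thesis by simp
qed

section \<open>Numerical bounds on logarithms\<close>

lemma exp_1_lower: "27 / 10 \<le> exp (1 :: real)"
proof -
  have "(145 / 128 :: real) \<le> exp (1 / 8)"
    using exp_lower_Taylor_quadratic[of "1 / 8"] by (simp add: power2_eq_square)
  then have "(145 / 128 :: real) ^ 8 \<le> exp (1 / 8) ^ 8" by (intro power_mono) auto
  also have "\<dots> = exp 1" by (simp flip: exp_of_nat_mult)
  finally show ?thesis by (simp add: power_divide)
qed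

text \<open>A quadratic bound for \<open>exp\<close> is too coarse at 3, so it is taken at 1/16 and
  raised to the power 48. The prime 23 is the least one above \<open>exp 3\<close>.\<close>

lemma ln_23_ge: "3 \<le> ln (23 :: real)"
proof -
  have "exp (1 / 16) \<le> (273 / 256 :: real)"
    using exp_bound[of "1 / 16"] by (simp add: power2_eq_square)
  then have "exp (1 / 16) ^ 48 \<le> (273 / 256 :: real) ^ 48" by (intro power_mono) auto
  also have "\<dots> \<le> 23" by (simp add: power_divide)
  also have "exp (1 / 16) ^ 48 = exp (3 :: real)" by (simp flip: exp_of_nat_mult)
  finally show ?thesis by (subst ln_ge_iff) auto
qed

lemma ln_3_bounds: "1 \<le> ln (3 :: real)" "ln (3 :: real) \<le> 6 / 5"
proof -
  show "1 \<le> ln (3 :: real)" using exp_le by (subst ln_ge_iff) auto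
  have "(178 / 100 :: real) \<le> exp (3 / 5)"
    using exp_lower_Taylor_quadratic[of "3 / 5"] by (simp add: power2_eq_square)
  then have "(178 / 100 :: real) ^ 2 \<le> exp (3 / 5) ^ 2" by (intro power_mono) auto
  also have "\<dots> = exp (6 / 5)" by (simp flip: exp_of_nat_mult)
  finally have "(3 :: real) \<le> exp (6 / 5)" by (simp add: power2_eq_square)
  then show "ln (3 :: real) \<le> 6 / 5" using ln_le_cancel_iff[of 3 "exp (6 / 5)"] by simp
qed

text \<open>The bound \<open>ln z \<le> z / exp 1\<close> at \<open>z = sqrt x\<close>; the constant
  is \<open>2 / 2.7\<close>.\<close>

lemma ln_le_sqrt:
  fixes x :: real
  assumes "0 < x"
  shows "ln x \<le> 20 / 27 * sqrt x"
proof -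
  have "ln (sqrt x) \<le> sqrt x / exp 1"
    using ln_le_minus_one[of "sqrt x / exp 1"] assms by (simp add: ln_div)
  also have "\<dots> \<le> sqrt x / (27 / 10)" using exp_1_lower assms by (intro divide_left_mono) auto
  finally have "ln (sqrt x) \<le> 10 / 27 * sqrt x" by simp
  moreover have "ln x = 2 * ln (sqrt x)" using assms by (simp add: ln_sqrt)
  ultimately show ?thesis by simp
qed

lemma ln_sq_le:
  fixes x :: real
  assumes "1 \<le> x"
  shows "(ln x)\<^sup>2 \<le> 400 / 729 * x"
proof -
  have "(ln x)\<^sup>2 \<le> (20 / 27 * sqrt x)\<^sup>2" using ln_le_sqrt[of x] assms by (intro power_mono) auto
  then show ?thesis using assms by (simp add: power_mult_distrib power2_eq_square)
qed

text \<open>The general estimate \<open>ln_sq_le\<close> suffices from 4 on but fails to give the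
  claim at 3, which is checked separately.\<close>

lemma four_ln_sq_le:
  fixes p :: real
  assumes "p = 3 \<or> 4 \<le> p"
  shows "4 * (ln p)\<^sup>2 \<le> 3 * (p - 1)"
proof (cases "p = 3")
  case True
  have "(ln (3 :: real))\<^sup>2 \<le> (6 / 5)\<^sup>2" using ln_3_bounds by (intro power_mono) auto
  then show ?thesis using True by (simp add: power2_eq_square)
next
  case False
  then show ?thesis using ln_sq_le[of p] assms by simp
qed

lemma four_ln_sq_plus_le:
  fixes p :: real
  assumes "23 \<le> p"
  shows "4 * (ln p)\<^sup>2 + 4 * ln p * (1 + 1 / p) \<le> 3 * (p - 1)"
proof -
  define s where "s = sqrt p"
  have s: "p = s * s" using assms by (simp add: s_def)
  have s1: "479 / 100 \<le> s" unfolding s_def using assms by (intro real_le_rsqrt) (simp add: power2_eq_square)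
  have "1 / p \<le> 1 / 23" using assms by (intro divide_left_mono) auto
  moreover have "ln p \<le> 20 / 27 * s" using ln_le_sqrt[of p] assms by (simp add: s_def)
  moreover have "0 \<le> ln p" using assms by simp
  ultimately have "ln p * (1 + 1 / p) \<le> (20 / 27 * s) * (24 / 23)"
    using assms s1 by (intro mult_mono) auto
  moreover have "479 / 100 * s \<le> s * s" using s1 by (intro mult_right_mono) auto
  ultimately have "ln p * (1 + 1 / p) \<le> 20 / 27 * (24 / 23) * (100 / 479) * (s * s)" by linarith
  then have "ln p * (1 + 1 / p) \<le> 20 / 27 * (24 / 23) * (100 / 479) * p" by (simp only: s[symmetric])
  then show ?thesis using ln_sq_le[of p] assms by simp
qed

text \<open>With \<open>u = 1 / p\<close> and \<open>y = l / ln p\<close>, the lower bound for the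
  power minus the upper bound for the quotient is \<open>y * u^2 / 6\<close> times
  \<open>3 * (l - 1) + 3 * y * (1 - u) - 2 * l^2 * u\<close>. The first term is nonnegative as
  \<open>l \<ge> 1\<close>, and \<open>four_ln_sq_le\<close> lets the second absorb the
  third.\<close>

lemma ln_ln_ratio_less_exp:
  fixes p l N e :: real
  assumes p: "p = 3 \<or> 4 \<le> p" and l: "1 \<le> l" "l \<le> 2 * ln p" and N: "p < N"
    and e: "ln (1 + 1 / p) / ln p \<le> e"
  shows "ln (N + l) / ln N < exp (l * e)"
proof -
  have p1: "1 < p" using p by auto
  define u y where "u = 1 / p" and "y = l / ln p"
  have lnp: "0 < ln p" using p1 by simp
  have u: "0 < u" "u < 1" "u * p = 1" using p1 by (auto simp: u_def)
  have y: "0 < y" "l = y * ln p" using l lnp by (auto simp: y_def)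
  have "2 * l * ln p \<le> 4 * (ln p)\<^sup>2" using l lnp by (simp add: power2_eq_square)
  also have "\<dots> \<le> 3 * (p - 1)" by (rule four_ln_sq_le[OF p])
  finally have "u * (2 * l * ln p) \<le> u * (3 * (p - 1))" using u by (intro mult_left_mono) auto
  then have "2 * l * ln p * u \<le> 3 * (1 - u)" using u by (simp add: algebra_simps)
  then have "y * (2 * l * ln p * u) \<le> y * (3 * (1 - u))" using y by (intro mult_left_mono) auto
  then have "2 * l\<^sup>2 * u \<le> 3 * y * (1 - u)" by (simp add: y(2) power2_eq_square mult_ac)
  then have "0 \<le> 3 * (l - 1) + 3 * y * (1 - u) - 2 * l\<^sup>2 * u" using l by simp
  then have "0 \<le> y * u\<^sup>2 / 6 * (3 * (l - 1) + 3 * y * (1 - u) - 2 * l\<^sup>2 * u)" using y by (intro mult_nonneg_nonneg) auto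
  also have "\<dots> = (1 + y * u - y * u\<^sup>2 / 2 + y\<^sup>2 * u\<^sup>2 * (1 - u) / 2) - (1 + y * (u - l * u\<^sup>2 / 2 + l\<^sup>2 * u ^ 3 / 3))"
    by (simp add: field_simps power2_eq_square power3_eq_cube)
  finally have "1 + y * (u - l * u\<^sup>2 / 2 + l\<^sup>2 * u ^ 3 / 3) \<le> 1 + y * u - y * u\<^sup>2 / 2 + y\<^sup>2 * u\<^sup>2 * (1 - u) / 2"
    by linarith
  also have "\<dots> \<le> exp (y * ln (1 + u))" using u y by (intro exp_mult_ln_one_plus_lower) auto
  also have "y * ln (1 + u) = l * (ln (1 + 1 / p) / ln p)" by (simp add: y_def u_def)
  also have "exp \<dots> \<le> exp (l * e)" unfolding exp_le_cancel_iff using e l by (intro mult_left_mono) auto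
  finally show ?thesis using ln_ln_ratio_upper[OF p1 _ N, of l] l by (simp add: y_def u_def)
qed

text \<open>As in \<open>ln_ln_ratio_less_exp\<close>, but the factor \<open>1 - \<delta>\<close>
  takes \<open>2 * l\<close> from \<open>3 * (l - 1)\<close>. What remains is \<open>l - 3\<close>,
  whence the bound \<open>3 \<le> l\<close>; the smaller terms of \<delta> times the power are
  absorbed by \<open>four_ln_sq_plus_le\<close>.\<close>

lemma ln_ln_ratio_less_exp_gain:
  fixes p l N e :: real
  assumes p: "23 \<le> p" and l: "3 \<le> l" "l \<le> 2 * ln p" and N: "p < N"
    and e: "ln (1 + 1 / p) / ln p \<le> e"
  shows "ln (N + l) / ln N < exp (l * e) * (1 - l\<^sup>2 / (3 * p\<^sup>2 * ln p))"
proof -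
  have p1: "1 < p" using p by auto
  define u y \<delta> where "u = 1 / p" and "y = l / ln p" and "\<delta> = l\<^sup>2 / (3 * p\<^sup>2 * ln p)"
  have lnp: "0 < ln p" using p1 by simp
  have u: "0 < u" "u < 1" "u * p = 1" using p1 by (auto simp: u_def)
  have y: "0 < y" "l = y * ln p" "y \<le> 2" using l lnp by (auto simp: y_def field_simps)
  have \<delta>: "\<delta> = y * l * u\<^sup>2 / 3" by (simp add: \<delta>_def y_def u_def power2_eq_square field_simps)
  have "l\<^sup>2 \<le> (2 * ln p)\<^sup>2" using l by (intro power_mono) auto
  also have "\<dots> = ln p * (4 * ln p)" by (simp add: power2_eq_square)
  also have "4 * ln p < 3 * p\<^sup>2"
  proof -
    have "ln p < p" using p1 by simp
    moreover have "23 * p \<le> p * p" using p by (intro mult_right_mono) auto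
    ultimately show ?thesis using p1 unfolding power2_eq_square by linarith
  qed
  finally have "l\<^sup>2 < 3 * p\<^sup>2 * ln p" using lnp by (simp add: mult.commute)
  \<comment> \<open>Positivity of \<open>1 - \<delta>\<close> is what allows inequalities to be
    multiplied by it below.\<close>
  then have \<delta>1: "l\<^sup>2 / (3 * p\<^sup>2 * ln p) < 1" using lnp p1 by simp
  define R where "R = 1 + y * u - y * u\<^sup>2 / 2 + y\<^sup>2 * u\<^sup>2 * (1 - u) / 2"
  have "y * u / 2 \<le> 1 * u" using mult_right_mono[of "y / 2" 1 u] y u by simp
  then have "l * (ln p + (1 + y * u / 2)) \<le> (2 * ln p) * (ln p + (1 + u))"
    using y u l lnp by (intro mult_mono) auto
  then have "2 * (l * (ln p + (1 + y * u / 2))) \<le> 2 * ((2 * ln p) * (ln p + (1 + u)))"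
    by (intro mult_left_mono) auto
  also have "\<dots> = 4 * (ln p)\<^sup>2 + 4 * ln p * (1 + 1 / p)"
    by (simp add: u_def power2_eq_square algebra_simps)
  also have "\<dots> \<le> 3 * (p - 1)" by (rule four_ln_sq_plus_le[OF p])
  finally have "2 * l * ln p + 2 * l * (1 + y * u / 2) \<le> 3 * (p - 1)" by (simp add: algebra_simps)
  then have "u * (2 * l * ln p + 2 * l * (1 + y * u / 2)) \<le> u * (3 * (p - 1))"
    using u by (intro mult_left_mono) auto
  also have "\<dots> = 3 * (1 - u)" using u by (simp add: algebra_simps)
  finally have "y * (u * (2 * l * ln p + 2 * l * (1 + y * u / 2))) \<le> y * (3 * (1 - u))"
    using y by (intro mult_left_mono) auto
  moreover have "y * (u * (2 * l * ln p + 2 * l * (1 + y * u / 2)))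
      = 2 * l * (y * ln p) * u + 2 * l * y * u * (1 + y * u / 2)"
    by (simp add: algebra_simps)
  then have "y * (u * (2 * l * ln p + 2 * l * (1 + y * u / 2)))
      = 2 * l\<^sup>2 * u + 2 * l * y * u * (1 + y * u / 2)"
    by (simp only: y(2)[symmetric] power2_eq_square mult.assoc)
  moreover have "y * (3 * (1 - u)) = 3 * y * (1 - u)" by simp
  ultimately have "2 * l\<^sup>2 * u + 2 * l * y * u * (1 + y * u / 2) \<le> 3 * y * (1 - u)" by linarith
  then have "0 \<le> (l - 3) + 3 * y * (1 - u) - 2 * l\<^sup>2 * u - 2 * l * y * u * (1 + y * u / 2)" using l by simp
  then have "0 \<le> y * u\<^sup>2 / 6 * ((l - 3) + 3 * y * (1 - u) - 2 * l\<^sup>2 * u - 2 * l * y * u * (1 + y * u / 2))"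
    using y by (intro mult_nonneg_nonneg) auto
  also have "\<dots> = R - \<delta> * (1 + y * u + y\<^sup>2 * u\<^sup>2 / 2) - (1 + y * (u - l * u\<^sup>2 / 2 + l\<^sup>2 * u ^ 3 / 3))"
    by (simp add: R_def \<delta> field_simps power2_eq_square power3_eq_cube)
  finally have "1 + y * (u - l * u\<^sup>2 / 2 + l\<^sup>2 * u ^ 3 / 3) \<le> R - \<delta> * (1 + y * u + y\<^sup>2 * u\<^sup>2 / 2)" by simp
  also have "\<dots> \<le> R - \<delta> * R"
  proof -
    have "y\<^sup>2 * u\<^sup>2 * (1 - u) \<le> y\<^sup>2 * u\<^sup>2" using u by (intro mult_left_le) auto
    moreover have "0 \<le> y * u\<^sup>2" using y by simp
    ultimately have "R \<le> 1 + y * u + y\<^sup>2 * u\<^sup>2 / 2" unfolding R_def by linarith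
    moreover have "0 \<le> \<delta>" using y l by (simp add: \<delta>)
    ultimately show ?thesis by (simp add: mult_left_mono)
  qed
  also have "\<dots> = R * (1 - \<delta>)" by (simp add: algebra_simps)
  also have "\<dots> \<le> exp (y * ln (1 + u)) * (1 - \<delta>)"
    unfolding R_def using u y \<delta>1 by (intro mult_right_mono exp_mult_ln_one_plus_lower) (auto simp: \<delta>_def)
  also have "y * ln (1 + u) = l * (ln (1 + 1 / p) / ln p)" by (simp add: y_def u_def)
  also have "exp \<dots> * (1 - \<delta>) \<le> exp (l * e) * (1 - \<delta>)"
    using e l \<delta>1 by (intro mult_right_mono iffD2[OF exp_le_cancel_iff] mult_left_mono) (auto simp: \<delta>_def)
  finally show "ln (N + l) / ln N < exp (l * e) * (1 - l\<^sup>2 / (3 * p\<^sup>2 * ln p))"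
    using ln_ln_ratio_upper[OF p1 _ N, of l] l by (simp add: y_def u_def \<delta>_def)
qed

section \<open>Growth of $G$\<close>

lemma next_prime_props: "prime (next_prime m)" "m < next_prime m"
proof -
  have "\<exists>p. prime p \<and> m < p" using bigger_prime by blast
  then have "prime (next_prime m) \<and> m < next_prime m" unfolding next_prime_def by (rule LeastI_ex)
  then show "prime (next_prime m)" "m < next_prime m" by auto
qed

text \<open>As \<open>p\<close> has exponent 0, \<open>ca_F (real p) 1\<close> is an element of
  \<open>ca_E\<close> below \<open>ca_eps i\<close>, hence not above the next one.\<close>

lemma ca_F_next_prime_le:
  assumes "1 \<le> i" and p: "p = next_prime (largest_prime_factor (ca_n i))"
  shows "ca_F (real p) 1 \<le> ca_eps (Suc i)"
proof -
  have pp: "prime p" "largest_prime_factor (ca_n i) < p" using next_prime_props p by auto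
  have n0: "ca_n i \<noteq> 0" using ca_number_pos[of "ca_eps i"] by (simp add: ca_n_def)
  have "p \<notin> prime_factors (ca_n i)"
  proof
    assume "p \<in> prime_factors (ca_n i)"
    then have "p \<le> largest_prime_factor (ca_n i)" by (simp add: largest_prime_factor_def)
    then show False using pp by simp
  qed
  then have "multiplicity p (ca_n i) = 0" using pp n0 by (auto simp: prime_factors_dvd intro: not_dvd_imp_multiplicity_0)
  then have "ca_exponent (ca_eps i) p = 0" by (simp add: ca_n_def multiplicity_ca_number[OF pp(1)])
  then have "ca_F (real p) 1 < ca_eps i"
    using ca_exponent_props(2)[OF ca_eps_pos pp(1), of i] by simp
  moreover have "ca_F (real p) 1 \<in> ca_E" using pp unfolding ca_E_def by blast
  ultimately show ?thesis using ca_eps_no_between assms(1) by blast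
qed

lemma ca_primes_le_prime:
  assumes "prime p" "ca_F (real p) 1 \<le> e" "q \<in> ca_primes e"
  shows "q \<le> p"
proof (rule ccontr)
  assume "\<not> q \<le> p"
  then have "ca_F (real q) 1 < ca_F (real p) 1"
    using prime_real_gt_1[OF assms(1)] by (intro ca_F_less_x) auto
  then show False using ca_primes_le(1)[OF assms(3)] assms(2) by linarith
qed

text \<open>The upper bound is where the six exponentials theorem enters: at most two primes share
  \<open>e\<close>, and each is at most \<open>p\<close>.\<close>

lemma Prod_ca_primes_bounds:
  assumes "prime p" "ca_F (real p) 1 \<le> e" "q \<in> ca_primes e"
  shows "ln (real q) \<le> ln (real (\<Prod>(ca_primes e)))" "ln (real (\<Prod>(ca_primes e))) \<le> 2 * ln (real p)"
proof -
  let ?M = "\<Prod>(ca_primes e)"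
  have M: "0 < ?M" by (intro prod_pos) (auto simp: ca_primes_def prime_gt_0_nat)
  have "q dvd ?M" using dvd_prodI[OF finite_ca_primes assms(3), of "\<lambda>x. x"] by simp
  then have "q \<le> ?M" using M by (intro dvd_imp_le)
  moreover have "0 < q" using assms(3) by (auto simp: ca_primes_def prime_gt_0_nat)
  ultimately show "ln (real q) \<le> ln (real ?M)" by (simp del: of_nat_prod)
  have p0: "0 < p" using assms(1) prime_gt_0_nat by blast
  have "?M \<le> (\<Prod>q\<in>ca_primes e. p)"
    using ca_primes_le_prime[OF assms(1,2)] by (intro prod_mono) auto
  also have "\<dots> = p ^ card (ca_primes e)" by simp
  also have "\<dots> \<le> p ^ 2" using card_ca_primes p0 by (intro power_increasing) auto
  finally have "real ?M \<le> real p ^ 2" by (metis of_nat_le_iff of_nat_power)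
  then have "ln (real ?M) \<le> ln (real p ^ 2)" using M by (intro ln_mono) (simp_all del: of_nat_prod)
  then show "ln (real ?M) \<le> 2 * ln (real p)" using p0 by (simp add: ln_realpow del: of_nat_prod)
qed

text \<open>The comparison is rearranged for \<open>G\<close>; \<open>c\<close> is 1 or the factor
  that records the gain.\<close>

lemma G_less_G_mult:
  assumes "rho (n * m) = rho n * real m powr e" "0 < rho n" "0 < m" "1 < ln (real n)" "0 < n"
    and l: "l = ln (real m)" and less: "ln (ln (real n) + l) / ln (ln (real n)) < exp (l * e) * c"
  shows "G n < G (n * m) * c"
proof -
  have "0 \<le> l" using assms(3) by (simp add: l Suc_le_eq)
  have L: "0 < ln (ln (real n))" using assms(4) by simp
  have L': "0 < ln (ln (real n) + l)" using assms(4) \<open>0 \<le> l\<close> by (intro ln_gt_zero) linarith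
  have "ln (real (n * m)) = ln (real n) + l" using assms by (simp add: ln_mult)
  moreover have "real m powr e = exp (l * e)" using assms(3) by (simp add: powr_def l mult.commute)
  ultimately have G: "G (n * m) = rho n * exp (l * e) / ln (ln (real n) + l)"
    by (simp add: G_def assms(1))
  have "ln (ln (real n) + l) < exp (l * e) * c * ln (ln (real n))"
    using less L by (simp add: pos_divide_less_eq)
  then have "1 / ln (ln (real n)) < exp (l * e) * c / ln (ln (real n) + l)"
    using L L' by (simp add: field_simps)
  then have "rho n * (1 / ln (ln (real n))) < rho n * (exp (l * e) * c / ln (ln (real n) + l))"
    using assms(2) by (rule mult_strict_left_mono)
  then show ?thesis unfolding G by (simp add: G_def)
qed

lemma rho_pos: "0 < n \<Longrightarrow> 0 < rho n"
proof -
  assume n: "0 < n"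
  have "sigma n \<noteq> 0" using n by (auto simp: sigma_def)
  then show ?thesis using n by (simp add: rho_def)
qed

text \<open>Stated with the logarithm \<open>l\<close> of the whole product, so that one prime and
  two primes are handled together. A single prime \<open>q\<close> in the set suffices for the size
  conditions, by \<open>q \<le> p\<close> and \<open>ln q \<le> l\<close>.\<close>

lemma CA3_step:
  assumes i: "1 \<le> i" and ca3: "CA3 (ca_n i)" and p: "p = next_prime (largest_prime_factor (ca_n i))"
    and q: "q \<in> ca_primes (ca_eps (Suc i))"
  defines "l \<equiv> ln (real (\<Prod>(ca_primes (ca_eps (Suc i)))))"
  shows "3 \<le> q \<Longrightarrow> G (ca_n i) < G (ca_n (Suc i))"
    and "23 \<le> q \<Longrightarrow> G (ca_n i) < G (ca_n (Suc i)) * (1 - l\<^sup>2 / (3 * (real p)\<^sup>2 * ln (real p)))"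
proof -
  define e where "e = ca_eps (Suc i)"
  define M where "M = \<Prod>(ca_primes e)"
  define n where "n = ca_n i"
  have q': "q \<in> ca_primes e" using q by (simp add: e_def)
  have pp: "prime p" using p next_prime_props by auto
  have pn: "real p < ln (real n)" using ca3 p by (simp add: CA3_def n_def)
  have pe: "ca_F (real p) 1 \<le> e" unfolding e_def by (rule ca_F_next_prime_le[OF i p])
  then have pe': "ln (1 + 1 / real p) / ln (real p) \<le> e" by (simp add: ca_F_def)
  have qp: "q \<le> p" by (rule ca_primes_le_prime[OF pp pe q'])
  have n0: "0 < n" using ca_number_pos by (simp add: n_def ca_n_def)
  have M0: "0 < M" unfolding M_def by (intro prod_pos) (auto simp: ca_primes_def prime_gt_0_nat)
  have nS: "ca_n (Suc i) = n * M" unfolding n_def M_def e_def by (rule ca_n_Suc(2)[OF i])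
  have rho: "rho (n * M) = rho n * real M powr e"
    unfolding M_def
    by (rule rho_mult_prod_primes[OF finite_ca_primes n0])
      (use ca_n_Suc(1)[OF i] in \<open>auto simp: e_def n_def ca_primes_def\<close>)
  have l: "ln (real q) \<le> l" "l \<le> 2 * ln (real p)"
    using Prod_ca_primes_bounds[OF pp pe q'] by (simp_all add: l_def e_def)
  have lM: "l = ln (real M)" by (simp add: l_def M_def e_def)
  have n1: "1 < ln (real n)" using pn prime_real_gt_1[OF pp] by linarith
  show "G (ca_n i) < G (ca_n (Suc i))" if "3 \<le> q"
  proof -
    have "ln 3 \<le> ln (real q)" using that by simp
    then have l1: "1 \<le> l" using l(1) ln_3_bounds(1) by linarith
    have "p = 3 \<or> 4 \<le> p" using that qp by linarith
    then have "real p = 3 \<or> 4 \<le> real p" by auto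
    from ln_ln_ratio_less_exp[OF this l1 l(2) pn pe']
    have "ln (ln (real n) + l) / ln (ln (real n)) < exp (l * e) * 1" by simp
    from G_less_G_mult[OF rho rho_pos[OF n0] M0 n1 n0 lM this] show ?thesis by (simp add: nS n_def)
  qed
  show "G (ca_n i) < G (ca_n (Suc i)) * (1 - l\<^sup>2 / (3 * (real p)\<^sup>2 * ln (real p)))" if "23 \<le> q"
  proof -
    have "ln 23 \<le> ln (real q)" using that by simp
    then have l3: "3 \<le> l" using l(1) ln_23_ge by linarith
    have p23: "23 \<le> real p" using that qp by linarith
    note gain = ln_ln_ratio_less_exp_gain[OF p23 l3 l(2) pn pe']
    from G_less_G_mult[OF rho rho_pos[OF n0] M0 n1 n0 lM gain]
    show "G (ca_n i) < G (ca_n (Suc i)) * (1 - l\<^sup>2 / (3 * (real p)\<^sup>2 * ln (real p)))"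
      by (simp add: nS n_def)
  qed
qed

lemma G_nonneg: "1 \<le> ln (real n) \<Longrightarrow> 0 \<le> G n"
  by (simp add: G_def rho_def)

text \<open>In the first two parts only the quotient depends on whether the value belongs to a
  single prime; the inequalities hold also for a shared value.\<close>

theorem theorem3:
  fixes i p :: nat
  assumes "i \<ge> 1"
    and "CA3 (ca_n i)"
    and "p = next_prime (largest_prime_factor (ca_n i))"
  shows
    "(\<forall>q k :: nat. prime q \<and> q \<ge> 3 \<and> k \<ge> 1 \<and> ca_eps (i + 1) = ca_F (real q) k \<longrightarrow>
        (ca_sole_prime (ca_eps (i + 1)) q \<longrightarrow> real (ca_n (i + 1)) / real (ca_n i) = real q) \<and>
        G (ca_n i) < G (ca_n (i + 1)))
     \<and> (\<forall>q k :: nat. prime q \<and> q \<ge> 23 \<and> k \<ge> 1 \<and> ca_eps (i + 1) = ca_F (real q) k \<longrightarrow>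
        (ca_sole_prime (ca_eps (i + 1)) q \<longrightarrow> real (ca_n (i + 1)) / real (ca_n i) = real q) \<and>
        G (ca_n i) < G (ca_n (i + 1)) * (1 - (ln (real q))\<^sup>2 / (3 * (real p)\<^sup>2 * ln (real p))))
     \<and> (\<forall>q r k j :: nat. prime q \<and> prime r \<and> q \<noteq> r \<and> q \<ge> 23 \<and> r \<ge> 23 \<and> k \<ge> 1 \<and> j \<ge> 1 \<and>
          ca_eps (i + 1) = ca_F (real q) k \<and> ca_eps (i + 1) = ca_F (real r) j \<longrightarrow>
        real (ca_n (i + 1)) / real (ca_n i) = real q * real r \<and>
        G (ca_n i) < G (ca_n (i + 1))
          * (1 - (ln (real q))\<^sup>2 / (3 * (real p)\<^sup>2 * ln (real p)))
          * (1 - (ln (real r))\<^sup>2 / (3 * (real p)\<^sup>2 * ln (real p))))"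
proof -
  define e n n' D where "e = ca_eps (i + 1)" and "n = ca_n i" and "n' = ca_n (i + 1)"
    and "D = 3 * (real p)\<^sup>2 * ln (real p)"
  define l where "l = ln (real (\<Prod>(ca_primes e)))"
  note step = CA3_step[OF assms, unfolded Suc_eq_plus1, folded e_def n_def n'_def D_def, folded l_def]
  have pp: "prime p" using assms(3) next_prime_props by auto
  have pe: "ca_F (real p) 1 \<le> e" using ca_F_next_prime_le[OF assms(1,3)] by (simp add: e_def)
  have n0: "0 < n" using ca_number_pos by (simp add: n_def ca_n_def)
  have D: "0 < D" using prime_real_gt_1[OF pp] by (simp add: D_def)
  have ratio: "real n' / real n = real (\<Prod>(ca_primes e))"
    using ca_n_Suc(2)[OF assms(1)] n0 by (simp add: n'_def n_def e_def)
  have mem: "q \<in> ca_primes e" if "prime q \<and> k \<ge> 1 \<and> e = ca_F (real q) k" for q k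
    using that by (auto simp: ca_primes_def)
  have sole: "real n' / real n = real q" if "q \<in> ca_primes e" "ca_sole_prime e q" for q
  proof -
    have "ca_primes e = {q}" using that unfolding ca_primes_def ca_sole_prime_def by blast
    then show ?thesis using ratio by simp
  qed
  \<comment> \<open>Positivity of \<open>G n'\<close>, read off from
    \<open>0 \<le> G n < G n'\<close>, is needed to compare multiples of it.\<close>
  have G': "0 < G n'" if "q \<in> ca_primes e" "23 \<le> q" for q
  proof -
    have "real p < ln (real n)" using assms by (simp add: CA3_def n_def)
    then have "1 < ln (real n)" using prime_real_gt_1[OF pp] by linarith
    then have "0 \<le> G n" by (intro G_nonneg) simp
    then show ?thesis using step(1)[OF that(1)] that(2) by simp
  qed
  have mono: "G n < G n' * (1 - x / D)" if "q \<in> ca_primes e" "23 \<le> q" "x \<le> l\<^sup>2" for q x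
  proof -
    have "1 - l\<^sup>2 / D \<le> 1 - x / D" using that(3) D by (simp add: divide_right_mono)
    then have "G n' * (1 - l\<^sup>2 / D) \<le> G n' * (1 - x / D)"
      using G'[OF that(1,2)] by (intro mult_left_mono) auto
    then show ?thesis using step(2)[OF that(1,2)] by linarith
  qed
  have ln_le: "0 \<le> ln (real q)" "ln (real q) \<le> l" if "q \<in> ca_primes e" for q
    using Prod_ca_primes_bounds(1)[OF pp pe that] that prime_real_gt_1(1)[of q]
    by (auto simp: l_def ca_primes_def)
  have part3: "real n' / real n = real q * real r \<and>
      G n < G n' * (1 - (ln (real q))\<^sup>2 / D) * (1 - (ln (real r))\<^sup>2 / D)"
    if qr: "q \<in> ca_primes e" "r \<in> ca_primes e" "q \<noteq> r" "23 \<le> q" for q r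
  proof -
    have "{q, r} = ca_primes e"
      using qr card_ca_primes[of e] by (intro card_seteq finite_ca_primes) auto
    then have Q: "\<Prod>(ca_primes e) = q * r" using qr(3) by (simp flip: \<open>{q, r} = ca_primes e\<close>)
    have "0 < q" "0 < r" using qr by (auto simp: ca_primes_def prime_gt_0_nat)
    then have "l = ln (real q) + ln (real r)" by (simp add: l_def Q ln_mult)
    then have "(ln (real q))\<^sup>2 + (ln (real r))\<^sup>2 \<le> l\<^sup>2"
      using ln_le(1)[OF qr(1)] ln_le(1)[OF qr(2)] by (simp add: power2_sum)
    then have "G n < G n' * (1 - ((ln (real q))\<^sup>2 + (ln (real r))\<^sup>2) / D)"
      by (intro mono[OF qr(1,4)])
    \<comment> \<open>The square of \<open>ln q + ln r\<close> has already been weakened to the sum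
      of squares; now \<open>1 - (a + b) \<le> (1 - a) * (1 - b)\<close> for nonnegative
      \<open>a * b\<close>.\<close>
    also have "\<dots> \<le> G n' * ((1 - (ln (real q))\<^sup>2 / D) * (1 - (ln (real r))\<^sup>2 / D))"
    proof (rule mult_left_mono)
      have "0 \<le> (ln (real q))\<^sup>2 / D * ((ln (real r))\<^sup>2 / D)" using D by simp
      then show "1 - ((ln (real q))\<^sup>2 + (ln (real r))\<^sup>2) / D
          \<le> (1 - (ln (real q))\<^sup>2 / D) * (1 - (ln (real r))\<^sup>2 / D)"
        by (simp add: algebra_simps add_divide_distrib)
    qed (use G'[OF qr(1,4)] in simp)
    finally show ?thesis using ratio Q by (simp add: mult.assoc)
  qed
  show ?thesis
    unfolding e_def[symmetric] n_def[symmetric] n'_def[symmetric] D_def[symmetric]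
  proof (intro conjI allI impI)
    fix q k assume q: "prime q \<and> 3 \<le> q \<and> 1 \<le> k \<and> e = ca_F (real q) k"
    show "real n' / real n = real q" if "ca_sole_prime e q" using sole mem q that by blast
    show "G n < G n'" using step(1) mem q by blast
  next
    fix q k assume q: "prime q \<and> 23 \<le> q \<and> 1 \<le> k \<and> e = ca_F (real q) k"
    show "real n' / real n = real q" if "ca_sole_prime e q" using sole mem q that by blast
    have m: "q \<in> ca_primes e" using mem q by blast
    have "(ln (real q))\<^sup>2 \<le> l\<^sup>2" using ln_le[OF m] by (intro power_mono)
    then show "G n < G n' * (1 - (ln (real q))\<^sup>2 / D)" using mono[OF m] q by blast
  next
    fix q r k j assume a: "prime q \<and> prime r \<and> q \<noteq> r \<and> 23 \<le> q \<and> 23 \<le> r \<and> 1 \<le> k \<and> 1 \<le> j \<and>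
      e = ca_F (real q) k \<and> e = ca_F (real r) j"
    have "q \<in> ca_primes e" "r \<in> ca_primes e" using mem a by blast+
    then have *: "real n' / real n = real q * real r \<and>
      G n < G n' * (1 - (ln (real q))\<^sup>2 / D) * (1 - (ln (real r))\<^sup>2 / D)" using part3 a by blast
    then show "real n' / real n = real q * real r"
      "G n < G n' * (1 - (ln (real q))\<^sup>2 / D) * (1 - (ln (real r))\<^sup>2 / D)" by auto
  qed
qed

end
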